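(* Let $G(V,E,\mathcal{F})$ be a regular labeled cuboid graph with iso-level $c\in(0,1)$. Suppose that $G$ contains only one reduced positive surface measure subgraph $H(V_h,E_h,\mathcal{F}_h)$ and that $H$ contains all disperse nodes of $G$. Then $G$ is irreducible and hence contains only one iso-path. Vice versa, if $G$ is irreducible, then there exists a subgraph $H(V_h,E_h,\mathcal{F}_h)$ of $G$ such that $H$ is the only reduced positive surface measure subgraph of $G$ and $H$ contains all disperse nodes of $G$.
   Context: **Labeled cuboid graphs.** A cuboid is $C=[a_1,b_1]\times[a_2,b_2]\times[a_3,b_3]\subset\mathbb{R}^3$. A labeled cuboid graph $G(V,E,\mathcal{F})$ consists of the 8 vertices $V$ and 12 edges $E$ of a cuboid (the cuboid of $G$) and $\mathcal{F}:V\to[0,1]$. A subgraph $H(V_h,E_h,\mathcal{F}_h)$ has $V_h\subset V$, $E_h\subset E$ (edges with end points in $V_h$), $\mathcal{F}_h=\mathcal{F}|_{V_h}$, and every node of $V_h$ is an end point of an edge in $E_h$. Two nodes are incident if they are the end points of an edge. Fix an iso-level $c\in(0,1)$. A node $P$ is disperse if $\mathcal{F}(P)>c$ and continuous if $\mathcal{F}(P)\le c$; $D(G)$ is the number of disperse nodes. $G$ (or a face, or an edge) is disperse (continuous) if all its nodes are. On an edge with end points $x_0,x_1$ such that $\mathcal{F}(x_0)\le c<\mathcal{F}(x_1)$, the iso-point is the point $x_0+(x_1-x_0)\frac{c-\mathcal{F}(x_0)}{\mathcal{F}(x_1)-\mathcal{F}(x_0)}$; these are all iso-points of $G$. An iso-node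 is a node that is an iso-point. An L-face is a face with exactly two disperse and two continuous nodes, the disperse ones not incident. $L(G)$ is the set of L-faces. A singular face has three disperse nodes and one iso-node. A regular face is one that is not an L-face, disperse, continuous or singular. Two graphs are face-neighbors if the intersection of their cuboids is a face of both. **Regular graphs.** A $T_1$-subgraph of $G$: a node with label $c$ together with its three incident nodes, all disperse. A $T_2$-subgraph: a subgraph with seven nodes, two of which are incident and have label $c$ while the other five are disperse. $G$ is an $F_1$-graph if there is $\tilde V\subset V$, $|\tilde V|=4$, with each $P\in\tilde V$ incident to exactly two nodes of $V\setminus\tilde V$, $\mathcal{F}=c$ on $\tilde V$ and $\mathcal{F}>c$ on $V\setminus\tilde V$. $G$ is an $F_2$-graph if it has a face-neighbor (in the cuboid mesh under consideration) such that all four common nodes have label $c$ and all other nodes of both graphs are disperse. $G$ is regular if it is neither disperse nor continuous, has no $T_1$- or $T_2$-subgraph and is not an $F_1$- or $F_2$-graph. **Basic subgraphs and reducibility.** $[g_1]_\circ$: the subgraphs consisting of a disperse node, its three incident nodes, all continuous, and the three joining edges. $[g_3]_\square$: the subgraphs consisting of a node with label $<c$, its three incident nodes, all disperse, and the three joining edges. A regular $G$ is reducible if $L(G)\neq\emptyset$, or $D(G)=2$ and $G$ has a subgraph in $[g_1]_\circ$, or $D(G)=6$ and $G$ has a subgraph in $[g_3]_\square$. A regular $G$ that is not reducible is irreducible. **Reduced positive surface measure subgraph.** A subgraph $H(V_h,E_h,\mathcal{F}_h)$ of a regular $G$ that is either in $[g_1]_\circ$, or has at least two disperse nodes and satisfies: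 (1) $H$ contains all incidence relations present in $G$ between the disperse nodes of $G$; (2) any two different disperse nodes of $H$ are connected by a path passing only through disperse edges of $H$; (3) all continuous nodes of $G$ incident to disperse nodes of $H$ are in $H$ and these are the only continuous nodes in $H$; (4) any edge in $E_h$ has at least one disperse end point; (5) $H$ contains no L-faces; (6) $H$ does not contain two different subgraphs of $G$ in $[g_3]_\square$. **Iso-path of a graph without L-faces.** On each regular face, the two iso-points lying on the edges of the face with one disperse and one continuous end point are joined by a segment (iso-line). An iso-path is a simple closed polygon formed by at least three such iso-lines with iso-points as vertices.
   Formalization: In condition (3), the edges joining the continuous nodes to the incident disperse nodes of H are also required to be in H; with nodes alone the converse fails, e.g. for three disperse nodes on one face, where H is not unique. *)

theory Defs
  imports "HOL-Analysis.Analysis"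
begin

section \<open>Labeled cuboid graphs\<close>

text \<open>
  The vertices and edges of a labeled cuboid graph are determined by its cuboid, so only
  the two extreme corners and the labeling are stored. An edge is the set of its two end points.
\<close>

record cuboid_graph =
  lo :: "real^3"
  hi :: "real^3"
  label :: "real^3 \<Rightarrow> real"

definition cuboid :: "cuboid_graph \<Rightarrow> (real^3) set" where
  "cuboid G = cbox (lo G) (hi G)"

definition verts :: "cuboid_graph \<Rightarrow> (real^3) set" where
  "verts G = {x. \<forall>i. x $ i = lo G $ i \<or> x $ i = hi G $ i}"

definition edges :: "cuboid_graph \<Rightarrow> (real^3) set set" where
  "edges G = {{x, y} | x y. x \<in> verts G \<and> y \<in> verts G \<and> card {i. x $ i \<noteq> y $ i} = 1}"

definition labeled_cuboid_graph :: "cuboid_graph \<Rightarrow> bool" where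
  "labeled_cuboid_graph G \<longleftrightarrow>
     (\<forall>i. lo G $ i < hi G $ i) \<and> label G \<in> verts G \<rightarrow>\<^sub>E {0..1}"

text \<open>Faces are the (full, two-dimensional) faces of the cuboid; the nodes of a face \<open>S\<close>
  are \<open>S \<inter> verts G\<close>.\<close>

definition faces :: "cuboid_graph \<Rightarrow> (real^3) set set" where
  "faces G = {{x \<in> cuboid G. x $ i = s} | i s. s = lo G $ i \<or> s = hi G $ i}"

definition incident :: "cuboid_graph \<Rightarrow> real^3 \<Rightarrow> real^3 \<Rightarrow> bool" where
  "incident G P Q \<longleftrightarrow> {P, Q} \<in> edges G"

definition face_neighbors :: "cuboid_graph \<Rightarrow> cuboid_graph \<Rightarrow> bool" where
  "face_neighbors G G' \<longleftrightarrow>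
     cuboid G \<inter> cuboid G' \<in> faces G \<and> cuboid G \<inter> cuboid G' \<in> faces G'"

text \<open>
  A cuboid mesh: non-overlapping cuboids whose graphs carry the same label at common nodes.
  Neither finiteness nor conformity is imposed, so every usual notion of mesh is covered.
\<close>

definition cuboid_mesh :: "cuboid_graph set \<Rightarrow> bool" where
  "cuboid_mesh M \<longleftrightarrow>
     (\<forall>G\<in>M. labeled_cuboid_graph G) \<and>
     (\<forall>G\<in>M. \<forall>G'\<in>M. G \<noteq> G' \<longrightarrow> interior (cuboid G) \<inter> interior (cuboid G') = {}) \<and>
     (\<forall>G\<in>M. \<forall>G'\<in>M. \<forall>P \<in> verts G \<inter> verts G'. label G P = label G' P)"

section \<open>Subgraphs\<close>

record cuboid_subgraph =
  sverts :: "(real^3) set"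
  sedges :: "(real^3) set set"
  slabel :: "real^3 \<Rightarrow> real"

text \<open>The labeling of a subgraph is the extensional restriction of the labeling of the graph,
  so that equality of subgraphs is equality of the triples (nodes, edges, labeling).\<close>

definition subgraph :: "cuboid_subgraph \<Rightarrow> cuboid_graph \<Rightarrow> bool" where
  "subgraph H G \<longleftrightarrow>
     sverts H \<subseteq> verts G \<and>
     sedges H \<subseteq> edges G \<and> (\<forall>e\<in>sedges H. e \<subseteq> sverts H) \<and>
     slabel H = restrict (label G) (sverts H) \<and>
     (\<forall>P\<in>sverts H. \<exists>e\<in>sedges H. P \<in> e)"

definition contains_subgraph :: "cuboid_subgraph \<Rightarrow> cuboid_subgraph \<Rightarrow> bool" where
  "contains_subgraph H A \<longleftrightarrow> sverts A \<subseteq> sverts H \<and> sedges A \<subseteq> sedges H"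

definition contains_face :: "cuboid_graph \<Rightarrow> cuboid_subgraph \<Rightarrow> (real^3) set \<Rightarrow> bool" where
  "contains_face G H S \<longleftrightarrow>
     S \<inter> verts G \<subseteq> sverts H \<and> {e \<in> edges G. e \<subseteq> S} \<subseteq> sedges H"

section \<open>Nodes, iso-points and types of faces for an iso-level \<open>c\<close>\<close>

definition disperse_nodes :: "real \<Rightarrow> cuboid_graph \<Rightarrow> (real^3) set" where
  "disperse_nodes c G = {P \<in> verts G. label G P > c}"

definition continuous_nodes :: "real \<Rightarrow> cuboid_graph \<Rightarrow> (real^3) set" where
  "continuous_nodes c G = {P \<in> verts G. label G P \<le> c}"

definition disperse_graph :: "real \<Rightarrow> cuboid_graph \<Rightarrow> bool" where
  "disperse_graph c G \<longleftrightarrow> verts G \<subseteq> disperse_nodes c G"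

definition continuous_graph :: "real \<Rightarrow> cuboid_graph \<Rightarrow> bool" where
  "continuous_graph c G \<longleftrightarrow> verts G \<subseteq> continuous_nodes c G"

definition iso_point :: "real \<Rightarrow> cuboid_graph \<Rightarrow> real^3 \<Rightarrow> real^3 \<Rightarrow> real^3" where
  "iso_point c G x0 x1 = x0 + ((c - label G x0) / (label G x1 - label G x0)) *\<^sub>R (x1 - x0)"

definition iso_points :: "real \<Rightarrow> cuboid_graph \<Rightarrow> (real^3) set" where
  "iso_points c G = {iso_point c G x0 x1 | x0 x1.
     {x0, x1} \<in> edges G \<and> label G x0 \<le> c \<and> c < label G x1}"

definition iso_nodes :: "real \<Rightarrow> cuboid_graph \<Rightarrow> (real^3) set" where
  "iso_nodes c G = verts G \<inter> iso_points c G"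

definition L_faces :: "real \<Rightarrow> cuboid_graph \<Rightarrow> (real^3) set set" where
  "L_faces c G = {S \<in> faces G.
     card (S \<inter> disperse_nodes c G) = 2 \<and> card (S \<inter> continuous_nodes c G) = 2 \<and>
     (\<forall>P \<in> S \<inter> disperse_nodes c G. \<forall>Q \<in> S \<inter> disperse_nodes c G. \<not> incident G P Q)}"

definition disperse_face :: "real \<Rightarrow> cuboid_graph \<Rightarrow> (real^3) set \<Rightarrow> bool" where
  "disperse_face c G S \<longleftrightarrow> S \<in> faces G \<and> S \<inter> verts G \<subseteq> disperse_nodes c G"

definition continuous_face :: "real \<Rightarrow> cuboid_graph \<Rightarrow> (real^3) set \<Rightarrow> bool" where
  "continuous_face c G S \<longleftrightarrow> S \<in> faces G \<and> S \<inter> verts G \<subseteq> continuous_nodes c G"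

definition singular_face :: "real \<Rightarrow> cuboid_graph \<Rightarrow> (real^3) set \<Rightarrow> bool" where
  "singular_face c G S \<longleftrightarrow>
     S \<in> faces G \<and> card (S \<inter> disperse_nodes c G) = 3 \<and> card (S \<inter> iso_nodes c G) = 1"

definition regular_face :: "real \<Rightarrow> cuboid_graph \<Rightarrow> (real^3) set \<Rightarrow> bool" where
  "regular_face c G S \<longleftrightarrow>
     S \<in> faces G \<and> S \<notin> L_faces c G \<and> \<not> disperse_face c G S \<and> \<not> continuous_face c G S \<and>
     \<not> singular_face c G S"

section \<open>Regular graphs\<close>

definition T1_subgraph :: "real \<Rightarrow> cuboid_graph \<Rightarrow> cuboid_subgraph \<Rightarrow> bool" where
  "T1_subgraph c G H \<longleftrightarrow> subgraph H G \<and>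
     (\<exists>P\<in>verts G. label G P = c \<and>
        sverts H = insert P {Q. incident G P Q} \<and>
        {Q. incident G P Q} \<subseteq> disperse_nodes c G)"

definition T2_subgraph :: "real \<Rightarrow> cuboid_graph \<Rightarrow> cuboid_subgraph \<Rightarrow> bool" where
  "T2_subgraph c G H \<longleftrightarrow> subgraph H G \<and> card (sverts H) = 7 \<and>
     (\<exists>P\<in>sverts H. \<exists>Q\<in>sverts H. incident G P Q \<and> label G P = c \<and> label G Q = c \<and>
        sverts H - {P, Q} \<subseteq> disperse_nodes c G)"

definition F1_graph :: "real \<Rightarrow> cuboid_graph \<Rightarrow> bool" where
  "F1_graph c G \<longleftrightarrow> (\<exists>W \<subseteq> verts G. card W = 4 \<and>
     (\<forall>P\<in>W. card {Q \<in> verts G - W. incident G P Q} = 2) \<and>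
     (\<forall>P\<in>W. label G P = c) \<and>
     (\<forall>P \<in> verts G - W. label G P > c))"

definition F2_graph :: "real \<Rightarrow> cuboid_graph set \<Rightarrow> cuboid_graph \<Rightarrow> bool" where
  "F2_graph c M G \<longleftrightarrow> (\<exists>G'\<in>M. face_neighbors G G' \<and>
     (\<forall>P \<in> verts G \<inter> verts G'. label G P = c \<and> label G' P = c) \<and>
     verts G - verts G' \<subseteq> disperse_nodes c G \<and>
     verts G' - verts G \<subseteq> disperse_nodes c G')"

definition regular_graph :: "real \<Rightarrow> cuboid_graph set \<Rightarrow> cuboid_graph \<Rightarrow> bool" where
  "regular_graph c M G \<longleftrightarrow>
     \<not> disperse_graph c G \<and> \<not> continuous_graph c G \<and>
     (\<nexists>H. T1_subgraph c G H) \<and> (\<nexists>H. T2_subgraph c G H) \<and>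
     \<not> F1_graph c G \<and> \<not> F2_graph c M G"

section \<open>Basic subgraphs and reducibility\<close>

definition g1_subgraphs :: "real \<Rightarrow> cuboid_graph \<Rightarrow> cuboid_subgraph set" where
  "g1_subgraphs c G = {H. subgraph H G \<and>
     (\<exists>P \<in> disperse_nodes c G.
        {Q. incident G P Q} \<subseteq> continuous_nodes c G \<and>
        sverts H = insert P {Q. incident G P Q} \<and>
        sedges H = {{P, Q} | Q. incident G P Q})}"

definition g3_subgraphs :: "real \<Rightarrow> cuboid_graph \<Rightarrow> cuboid_subgraph set" where
  "g3_subgraphs c G = {H. subgraph H G \<and>
     (\<exists>P \<in> verts G. label G P < c \<and>
        {Q. incident G P Q} \<subseteq> disperse_nodes c G \<and>
        sverts H = insert P {Q. incident G P Q} \<and>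
        sedges H = {{P, Q} | Q. incident G P Q})}"

definition reducible_graph :: "real \<Rightarrow> cuboid_graph set \<Rightarrow> cuboid_graph \<Rightarrow> bool" where
  "reducible_graph c M G \<longleftrightarrow> regular_graph c M G \<and>
     (L_faces c G \<noteq> {} \<or>
      (card (disperse_nodes c G) = 2 \<and> g1_subgraphs c G \<noteq> {}) \<or>
      (card (disperse_nodes c G) = 6 \<and> g3_subgraphs c G \<noteq> {}))"

definition irreducible_graph :: "real \<Rightarrow> cuboid_graph set \<Rightarrow> cuboid_graph \<Rightarrow> bool" where
  "irreducible_graph c M G \<longleftrightarrow> regular_graph c M G \<and> \<not> reducible_graph c M G"

section \<open>Reduced positive surface measure subgraphs\<close>

text \<open>
  In the third condition of the second alternative, \<open>H\<close> contains a continuous node \<open>Q\<close> incident to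
  one of its disperse nodes \<open>P\<close> as a node incident to \<open>P\<close>, i.e. together with the edge joining them.
  Without these edges \<open>H\<close> would not be determined by its nodes: a continuous node with two disperse
  neighbors in \<open>H\<close> could be attached to either one or to both, and no uniqueness could hold.
\<close>

definition reduced_psm_subgraph ::
    "real \<Rightarrow> cuboid_graph set \<Rightarrow> cuboid_graph \<Rightarrow> cuboid_subgraph \<Rightarrow> bool" where
  "reduced_psm_subgraph c M G H \<longleftrightarrow> regular_graph c M G \<and> subgraph H G \<and>
     (H \<in> g1_subgraphs c G \<or>
      (card (sverts H \<inter> disperse_nodes c G) \<ge> 2 \<and>
       (\<forall>P \<in> disperse_nodes c G. \<forall>Q \<in> disperse_nodes c G.
          incident G P Q \<longrightarrow> {P, Q} \<in> sedges H) \<and>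
       (\<forall>P \<in> sverts H \<inter> disperse_nodes c G. \<forall>Q \<in> sverts H \<inter> disperse_nodes c G. P \<noteq> Q \<longrightarrow>
          (P, Q) \<in> {(x, y). {x, y} \<in> sedges H \<and> {x, y} \<subseteq> disperse_nodes c G}\<^sup>*) \<and>
       ((\<forall>P \<in> sverts H \<inter> disperse_nodes c G. \<forall>Q \<in> continuous_nodes c G.
           incident G P Q \<longrightarrow> Q \<in> sverts H \<and> {P, Q} \<in> sedges H) \<and>
        (\<forall>Q \<in> sverts H \<inter> continuous_nodes c G.
           \<exists>P \<in> sverts H \<inter> disperse_nodes c G. incident G P Q)) \<and>
       (\<forall>e \<in> sedges H. \<exists>P \<in> e. P \<in> disperse_nodes c G) \<and>
       \<not> (\<exists>S \<in> L_faces c G. contains_face G H S) \<and>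
       \<not> (\<exists>A \<in> g3_subgraphs c G. \<exists>B \<in> g3_subgraphs c G.
            A \<noteq> B \<and> contains_subgraph H A \<and> contains_subgraph H B)))"

section \<open>Iso-paths\<close>

definition face_iso_points :: "real \<Rightarrow> cuboid_graph \<Rightarrow> (real^3) set \<Rightarrow> (real^3) set" where
  "face_iso_points c G S = {iso_point c G x0 x1 | x0 x1.
     {x0, x1} \<in> edges G \<and> {x0, x1} \<subseteq> S \<and> label G x0 \<le> c \<and> c < label G x1}"

text \<open>\<open>iso_line c G p q\<close>: the segment from \<open>p\<close> to \<open>q\<close> is an iso-line.\<close>

definition iso_line :: "real \<Rightarrow> cuboid_graph \<Rightarrow> real^3 \<Rightarrow> real^3 \<Rightarrow> bool" where
  "iso_line c G p q \<longleftrightarrow>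
     p \<noteq> q \<and> (\<exists>S. regular_face c G S \<and> face_iso_points c G S = {p, q})"

fun polygonal_path :: "'a::real_normed_vector list \<Rightarrow> real \<Rightarrow> 'a" where
  "polygonal_path [] = linepath 0 0"
| "polygonal_path [p] = linepath p p"
| "polygonal_path [p, q] = linepath p q"
| "polygonal_path (p # q # r # ps) = linepath p q +++ polygonal_path (q # r # ps)"

text \<open>
  An iso-path is a closed polygon regarded as a point set, so that neither the starting vertex
  nor the orientation matters. The definition is meant for graphs without L-faces.
\<close>

definition iso_path :: "real \<Rightarrow> cuboid_graph \<Rightarrow> (real^3) set \<Rightarrow> bool" where
  "iso_path c G K \<longleftrightarrow> (\<exists>ps. length ps \<ge> 3 \<and>
     (\<forall>i < length ps. iso_line c G (ps ! i) (ps ! (Suc i mod length ps))) \<and>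
     simple_path (polygonal_path (ps @ [hd ps])) \<and>
     K = path_image (polygonal_path (ps @ [hd ps])))"

end

(*
  Nodes of the cuboid are related by the reflections P |-> flip i P in the three axes. A node P and a
  permutation (i, j, k) of the axes form a frame in which all eight nodes, all faces and all
  edges are written down, so that no generality is lost by starting at any prescribed edge.

  On a graph that is regular and irreducible every iso-point is an end point of exactly two iso-lines:
  each of the two faces at a cut edge contributes one, and the only possible degenerations, at
  iso-nodes, are excluded by the absence of T1-subgraphs, T2-subgraphs and L-faces. A finite
  graph of minimal degree 2 contains a cycle, and iso-lines meet only in common end points, so the
  cycle is a simple closed polygon. Since all degrees are at most 2, the vertex set of any
  iso-path is closed under iso-lines; since iso-points are connected by iso-lines, every
  iso-path runs through all of them and is the union of all iso-lines. The connectedness is a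
  finite statement about the 2-colourings of the nodes of a cube that have no L-face and in which
  no two antipodal nodes are coloured differently from the six others.

  If no disperse node is isolated, the conditions determine a reduced positive surface measure
  subgraph: it consists of the disperse nodes, their neighbours and all edges with a disperse
  end point. Without L-faces, disperse nodes at distance two are joined through a third one, which
  gives the connectedness required of that subgraph.
*)

theory Submission
  imports Defs
begin

section \<open>Cyclic chains and closed polygons\<close>

definition cyclic_chain :: "('a \<Rightarrow> 'a \<Rightarrow> bool) \<Rightarrow> 'a list \<Rightarrow> bool" where
  "cyclic_chain R ps \<longleftrightarrow> (\<forall>i<length ps. R (ps ! i) (ps ! (Suc i mod length ps)))"

text \<open>A longest simple path in \<open>V\<close> contains all neighbours in \<open>V\<close> of
  its first vertex. Of two such neighbours at least one is not the second vertex, and cutting the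
  path there closes a cycle of length at least 3.\<close>

lemma ex_cyclic_chain:
  assumes fin: "finite V" and ne: "V \<noteq> {}" and sym: "\<And>p q. R p q \<Longrightarrow> R q p"
    and irrefl: "\<And>p. \<not> R p p"
    and deg: "\<And>p. p \<in> V \<Longrightarrow> \<exists>q1\<in>V. \<exists>q2\<in>V. q1 \<noteq> q2 \<and> R p q1 \<and> R p q2"
  shows "\<exists>ps. length ps \<ge> 3 \<and> distinct ps \<and> set ps \<subseteq> V \<and> cyclic_chain R ps"
proof -
  define P where "P xs \<longleftrightarrow> xs \<noteq> [] \<and> distinct xs \<and> set xs \<subseteq> V \<and>
      (\<forall>i. Suc i < length xs \<longrightarrow> R (xs ! i) (xs ! Suc i))" for xs
  obtain v where v: "v \<in> V" using ne by auto
  have "P [v]" using v by (auto simp: P_def)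
  moreover have "\<forall>xs. P xs \<longrightarrow> length xs \<le> card V"
    unfolding P_def by (metis distinct_card card_mono fin)
  ultimately obtain xs where xs: "P xs" and max: "\<And>ys. P ys \<Longrightarrow> length ys \<le> length xs"
    using ex_has_greatest_nat[of P "[v]" length "Suc (card V)"] by (auto simp: less_Suc_eq_le)
  have ne: "xs \<noteq> []" and dist: "distinct xs" and sub: "set xs \<subseteq> V"
    and step: "\<And>i. Suc i < length xs \<Longrightarrow> R (xs ! i) (xs ! Suc i)"
    using xs by (auto simp: P_def)
  have hd: "xs ! 0 \<in> V" using ne sub by (metis hd_conv_nth hd_in_set subsetD)
  have nb: "q \<in> set xs" if "R (xs ! 0) q" "q \<in> V" for q
  proof (rule ccontr)
    assume "q \<notin> set xs"
    then have "P (q # xs)"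
      using that dist sub step sym unfolding P_def by (auto simp: nth_Cons split: nat.splits)
    then show False using max[of "q # xs"] by simp
  qed
  obtain q1 q2 where q: "q1 \<in> V" "q2 \<in> V" "q1 \<noteq> q2" "R (xs ! 0) q1" "R (xs ! 0) q2"
    using deg[OF hd] by blast
  obtain j1 where j1: "j1 < length xs" "q1 = xs ! j1" using nb q by (metis in_set_conv_nth)
  obtain j2 where j2: "j2 < length xs" "q2 = xs ! j2" using nb q by (metis in_set_conv_nth)
  \<comment> \<open>Irreflexivity excludes index 0, and \<open>q1\<close> and \<open>q2\<close>
    differ, so one of the two indices is at least 2.\<close>
  have "j1 \<noteq> 0" "j2 \<noteq> 0" "j1 \<noteq> j2" using q j1 j2 irrefl by metis+
  then obtain j where j: "2 \<le> j" "j < length xs" "R (xs ! 0) (xs ! j)"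
    using q j1 j2 by (metis One_nat_def Suc_1 Suc_leI le_neq_implies_less not_gr_zero)
  let ?ps = "take (Suc j) xs"
  have len: "length ?ps = Suc j" using j by simp
  have "cyclic_chain R ?ps"
    unfolding cyclic_chain_def len
  proof (intro allI impI)
    fix i assume i: "i < Suc j"
    show "R (?ps ! i) (?ps ! (Suc i mod Suc j))"
    proof (cases "i = j")
      case True then show ?thesis using j sym by simp
    next
      case False then show ?thesis using i j step by simp
    qed
  qed
  moreover have "set ?ps \<subseteq> V" using sub set_take_subset[of "Suc j" xs] by blast
  ultimately show ?thesis using len j dist by (intro exI[of _ ?ps]) auto
qed

text \<open>Length at least 3 makes the predecessor and the successor of \<open>p\<close> two
  different neighbours; degree at most 2 leaves no other.\<close>

lemma cyclic_chain_neighbor: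
  assumes cyc: "cyclic_chain R ps" and len: "length ps \<ge> 3" and dist: "distinct ps"
    and sym: "\<And>p q. R p q \<Longrightarrow> R q p"
    and deg: "\<And>p q1 q2 q3. R p q1 \<Longrightarrow> R p q2 \<Longrightarrow> R p q3 \<Longrightarrow> q1 = q2 \<or> q1 = q3 \<or> q2 = q3"
    and p: "p \<in> set ps" and pq: "R p q"
  shows "\<exists>i<length ps. {p, q} = {ps ! i, ps ! (Suc i mod length ps)}"
proof -
  let ?n = "length ps"
  obtain i where i: "i < ?n" "p = ps ! i" using p by (metis in_set_conv_nth)
  \<comment> \<open>\<open>h\<close> is the cyclic predecessor of \<open>i\<close>.\<close>
  define h where "h = (if i = 0 then ?n - 1 else i - 1)"
  have h: "h < ?n" "Suc h mod ?n = i" using i len by (auto simp: h_def)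
  have s: "Suc i mod ?n < ?n" using len by (intro mod_less_divisor) linarith
  have "h \<noteq> Suc i mod ?n"
    using i len by (cases "Suc i = ?n") (auto simp: h_def)
  then have "ps ! h \<noteq> ps ! (Suc i mod ?n)"
    using dist h s by (simp add: nth_eq_iff_index_eq)
  moreover have "R p (ps ! (Suc i mod ?n))" "R p (ps ! h)"
    using cyc i h sym unfolding cyclic_chain_def by metis+
  ultimately have "q = ps ! h \<or> q = ps ! (Suc i mod ?n)" using deg pq by metis
  then show ?thesis using i h by (metis insert_commute)
qed

section \<open>Polygonal paths that are arcs or simple loops\<close>

lemma pathstart_polygonal_path [simp]:
  "ps \<noteq> [] \<Longrightarrow> pathstart (polygonal_path ps) = hd ps"
  by (induction ps rule: polygonal_path.induct) auto

lemma pathfinish_polygonal_path [simp]: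
  "ps \<noteq> [] \<Longrightarrow> pathfinish (polygonal_path ps) = last ps"
  by (induction ps rule: polygonal_path.induct) auto

lemma path_image_polygonal_path:
  "length ps \<ge> 2 \<Longrightarrow> path_image (polygonal_path ps) =
     (\<Union>i\<in>{i. Suc i < length ps}. closed_segment (ps ! i) (ps ! Suc i))"
proof (induction ps rule: polygonal_path.induct)
  case (4 p q r ps)
  have eq: "{i. Suc i < length (p # q # r # ps)} = insert 0 (Suc ` {i. Suc i < length (q # r # ps)})"
    by (auto simp: image_iff) (metis Suc_less_eq Suc_pred gr0I)
  show ?case unfolding eq using 4 by (simp add: path_image_join)
qed (auto simp: less_Suc_eq)

lemma set_subset_path_image_polygonal_path:
  "length ps \<ge> 2 \<Longrightarrow> set ps \<subseteq> path_image (polygonal_path ps)"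
  by (induction ps rule: polygonal_path.induct) (auto simp: path_image_join)

text \<open>By \<open>arc_join_eq\<close> the first segment meets the remaining path only in
  \<open>q\<close>, so \<open>p\<close> does not occur among the later vertices.\<close>

lemma distinct_if_arc_polygonal_path:
  "length ps \<ge> 2 \<Longrightarrow> arc (polygonal_path ps) \<Longrightarrow> distinct ps"
proof (induction ps rule: polygonal_path.induct)
  case (4 p q r ps)
  then have a: "arc (linepath p q)" "arc (polygonal_path (q # r # ps))"
    "path_image (linepath p q) \<inter> path_image (polygonal_path (q # r # ps)) \<subseteq> {q}"
    by (auto simp: arc_join_eq)
  have "p \<noteq> q" using a(1) arc_distinct_ends by fastforce
  moreover have "p \<in> path_image (linepath p q)" by simp
  ultimately have "p \<notin> path_image (polygonal_path (q # r # ps))" using a(3) by blast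
  then have "p \<notin> set (q # r # ps)"
    using set_subset_path_image_polygonal_path[of "q # r # ps"] by auto
  then show ?case using 4 a by simp
qed (auto dest: arc_distinct_ends)

text \<open>The segment condition confines the intersection of the first segment with the rest to
  common vertices, and distinctness leaves only the joint \<open>q\<close>, as required for joining
  two arcs.\<close>

lemma arc_polygonal_path:
  assumes "length ps \<ge> 2" "distinct ps"
    and "\<And>i j. i < j \<Longrightarrow> Suc j < length ps \<Longrightarrow>
      closed_segment (ps ! i) (ps ! Suc i) \<inter> closed_segment (ps ! j) (ps ! Suc j)
        \<subseteq> {ps ! i, ps ! Suc i} \<inter> {ps ! j, ps ! Suc j}"
  shows "arc (polygonal_path ps)"
  using assms
proof (induction ps rule: polygonal_path.induct)
  case (4 p q r ps)
  let ?qs = "q # r # ps"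
  have "arc (polygonal_path ?qs)"
  proof (rule "4.IH")
    fix i j assume "i < j" "Suc j < length ?qs"
    then show "closed_segment (?qs ! i) (?qs ! Suc i) \<inter> closed_segment (?qs ! j) (?qs ! Suc j)
        \<subseteq> {?qs ! i, ?qs ! Suc i} \<inter> {?qs ! j, ?qs ! Suc j}"
      using "4.prems"(3)[of "Suc i" "Suc j"] by simp
  qed (use 4 in auto)
  moreover have "arc (linepath p q)" using 4 by auto
  moreover have "path_image (linepath p q) \<inter> path_image (polygonal_path ?qs) \<subseteq> {q}"
  proof
    fix z assume z: "z \<in> path_image (linepath p q) \<inter> path_image (polygonal_path ?qs)"
    then obtain j where j: "Suc j < length ?qs" "z \<in> closed_segment (?qs ! j) (?qs ! Suc j)"
      by (auto simp: path_image_polygonal_path)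
    then have "z \<in> {p, q} \<inter> {?qs ! j, ?qs ! Suc j}"
      using "4.prems"(3)[of 0 "Suc j"] z by auto
    moreover have "?qs ! j \<in> set ?qs" "?qs ! Suc j \<in> set ?qs"
      using j(1) by (metis Suc_lessD nth_mem, metis nth_mem)
    ultimately show "z \<in> {q}" using "4.prems"(2) by auto
  qed
  ultimately show ?case by (simp add: arc_join_eq)
qed auto

text \<open>Translates indices in a list closed by its head into successors modulo the length, the
  indexing used in \<open>iso_path\<close>.\<close>

lemma closed_nth:
  assumes "ps \<noteq> []" "i < length ps"
  shows "(ps @ [hd ps]) ! i = ps ! i" "(ps @ [hd ps]) ! Suc i = ps ! (Suc i mod length ps)"
  using assms by (auto simp: nth_append hd_conv_nth mod_Suc Suc_lessI)

lemma path_image_closed_polygonal_path: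
  assumes "ps \<noteq> []"
  shows "path_image (polygonal_path (ps @ [hd ps])) =
     (\<Union>i<length ps. closed_segment (ps ! i) (ps ! (Suc i mod length ps)))"
  using assms by (subst path_image_polygonal_path) (auto simp: closed_nth Suc_le_eq)

text \<open>The loop is the segment from \<open>a\<close> to \<open>b\<close> followed by an arc
  from \<open>b\<close> back to \<open>a\<close>; the two pieces meet only in \<open>a\<close> and
  \<open>b\<close>.\<close>

lemma simple_closed_polygonal_path:
  assumes len: "length ps \<ge> 3" and dist: "distinct ps"
    and disj: "\<And>i j. i < j \<Longrightarrow> j < length ps \<Longrightarrow>
      closed_segment (ps ! i) (ps ! (Suc i mod length ps)) \<inter>
      closed_segment (ps ! j) (ps ! (Suc j mod length ps))
        \<subseteq> {ps ! i, ps ! (Suc i mod length ps)} \<inter> {ps ! j, ps ! (Suc j mod length ps)}"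
  shows "simple_path (polygonal_path (ps @ [hd ps]))"
proof -
  obtain a b c' ds where ps: "ps = a # b # c' # ds"
    using len by (metis Suc_le_length_iff numeral_3_eq_3)
  let ?xs = "ps @ [a]" and ?qs = "b # c' # ds @ [a]"
  have disj': "closed_segment (?xs ! i) (?xs ! Suc i) \<inter> closed_segment (?xs ! j) (?xs ! Suc j)
        \<subseteq> {?xs ! i, ?xs ! Suc i} \<inter> {?xs ! j, ?xs ! Suc j}" if "i < j" "Suc j < length ?xs" for i j
    using disj[of i j] closed_nth[of ps i] closed_nth[of ps j] that ps by auto
  have "arc (polygonal_path ?qs)"
  proof (rule arc_polygonal_path)
    fix i j assume "i < j" "Suc j < length ?qs"
    then show "closed_segment (?qs ! i) (?qs ! Suc i) \<inter> closed_segment (?qs ! j) (?qs ! Suc j)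
        \<subseteq> {?qs ! i, ?qs ! Suc i} \<inter> {?qs ! j, ?qs ! Suc j}"
      using disj'[of "Suc i" "Suc j"] by (simp add: ps)
  qed (use dist ps in auto)
  moreover have "arc (linepath a b)" using dist ps by auto
  moreover have "path_image (linepath a b) \<inter> path_image (polygonal_path ?qs) \<subseteq> {a, b}"
  proof
    fix z assume z: "z \<in> path_image (linepath a b) \<inter> path_image (polygonal_path ?qs)"
    then obtain j where j: "Suc j < length ?qs" "z \<in> closed_segment (?qs ! j) (?qs ! Suc j)"
      by (auto simp: path_image_polygonal_path)
    then show "z \<in> {a, b}" using disj'[of 0 "Suc j"] z by (auto simp: ps)
  qed
  ultimately have "simple_path (linepath a b +++ polygonal_path ?qs)"
    by (simp add: simple_path_join_loop_eq)
  then show ?thesis by (simp add: ps)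
qed

text \<open>Removing the first segment leaves an arc that still passes through all vertices.\<close>

lemma distinct_if_simple_closed_polygonal_path:
  assumes len: "length ps \<ge> 3" and s: "simple_path (polygonal_path (ps @ [hd ps]))"
  shows "distinct ps"
proof -
  obtain a b c' ds where ps: "ps = a # b # c' # ds"
    using len by (metis Suc_le_length_iff numeral_3_eq_3)
  let ?qs = "b # c' # ds @ [a]"
  have "simple_path (linepath a b +++ polygonal_path ?qs)" using s by (simp add: ps)
  then have "arc (polygonal_path ?qs)" by (simp add: simple_path_join_loop_eq)
  then have "distinct ?qs" by (intro distinct_if_arc_polygonal_path) auto
  then show ?thesis by (auto simp: ps)
qed

section \<open>Nodes, edges and faces of a cuboid\<close>

lemma axis_cases:
  fixes i j k m :: 3
  assumes "i \<noteq> j" "i \<noteq> k" "j \<noteq> k"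
  shows "m = i \<or> m = j \<or> m = k"
proof -
  have "card {i, j, k} = CARD(3)" using assms by simp
  then have "{i, j, k} = UNIV" by (intro card_subset_eq) auto
  then show ?thesis by blast
qed

lemma obtain_axes:
  fixes i :: 3
  obtains j k where "i \<noteq> j" "i \<noteq> k" "j \<noteq> k"
proof -
  have "card (UNIV - {i}) = 2" by (simp add: card_Diff_singleton)
  then obtain j k where "UNIV - {i} = {j, k}" "j \<noteq> k" unfolding card_2_iff by blast
  then show thesis using that[of j k] by blast
qed

lemma obtain_third_axis:
  fixes i j :: 3
  assumes "i \<noteq> j"
  obtains k where "i \<noteq> k" "j \<noteq> k"
proof -
  have "card (UNIV - {i, j}) = 1" using assms by (simp add: card_Diff_subset)
  then obtain k where "UNIV - {i, j} = {k}" by (rule card_1_singletonE)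
  then show thesis using that[of k] by blast
qed

locale cuboid_level =
  fixes c :: real and G :: cuboid_graph
  assumes lo_less_hi: "\<And>i. lo G $ i < hi G $ i"
begin

text \<open>Reflection in the mid-plane of the cuboid orthogonal to axis \<open>i\<close>. These
  maps are commuting involutions of the whole space; on nodes they move along the edges.\<close>

definition flip :: "3 \<Rightarrow> real^3 \<Rightarrow> real^3" where
  "flip i P = (\<chi> m. if m = i then lo G $ m + hi G $ m - P $ m else P $ m)"

text \<open>For a node \<open>P\<close> this is a member of \<open>faces G\<close>, named by its
  normal axis and any one of its nodes.\<close>

definition face :: "3 \<Rightarrow> real^3 \<Rightarrow> (real^3) set" where
  "face i P = {x \<in> cuboid G. x $ i = P $ i}"

abbreviation V where "V \<equiv> verts G"
abbreviation D where "D \<equiv> disperse_nodes c G"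
abbreviation C where "C \<equiv> continuous_nodes c G"

lemma flip_nth [simp]: "flip i P $ m = (if m = i then lo G $ m + hi G $ m - P $ m else P $ m)"
  by (simp add: flip_def)

lemma flip_flip [simp]: "flip i (flip i P) = P"
  by (simp add: vec_eq_iff)

lemma flip_commute: "flip i (flip j P) = flip j (flip i P)"
  by (simp add: vec_eq_iff)

lemma flip_inject [simp]: "flip i P = flip i Q \<longleftrightarrow> P = Q"
  by (metis flip_flip)

lemma flip_in_verts [simp]: "flip i P \<in> V \<longleftrightarrow> P \<in> V"
proof -
  have *: "flip i P \<in> V" if "P \<in> V" for P
    unfolding verts_def mem_Collect_eq
  proof
    fix m
    have "P $ m = lo G $ m \<or> P $ m = hi G $ m" using that by (simp add: verts_def)
    then show "flip i P $ m = lo G $ m \<or> flip i P $ m = hi G $ m" by auto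
  qed
  show ?thesis using *[of P] *[of "flip i P"] by auto
qed

lemma flip_nth_neq: "P \<in> V \<Longrightarrow> lo G $ i + hi G $ i - P $ i \<noteq> P $ i"
proof -
  assume "P \<in> V"
  then have "P $ i = lo G $ i \<or> P $ i = hi G $ i" by (simp add: verts_def)
  then show ?thesis using lo_less_hi[of i] by auto
qed

lemma verts_nth_cases:
  "P \<in> V \<Longrightarrow> Q \<in> V \<Longrightarrow> Q $ i = P $ i \<or> Q $ i = lo G $ i + hi G $ i - P $ i"
  by (auto simp: verts_def dest!: spec[of _ i])

lemma flip_neq [simp]:
  assumes "P \<in> V"
  shows "flip i P \<noteq> P" "P \<noteq> flip i P"
  using flip_nth_neq[OF assms, of i] by (auto simp: vec_eq_iff)

lemma flip2_neq [simp]: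
  assumes "P \<in> V" "i \<noteq> j"
  shows "flip i P \<noteq> flip j P" "flip i (flip j P) \<noteq> P" "P \<noteq> flip i (flip j P)"
  using flip_nth_neq[OF assms(1), of i] assms(2) by (auto simp: vec_eq_iff)

lemma flip3_neq [simp]:
  assumes "P \<in> V" "i \<noteq> j" "i \<noteq> k" "j \<noteq> k"
  shows "flip i (flip j (flip k P)) \<noteq> P" "P \<noteq> flip i (flip j (flip k P))"
    "flip i (flip j P) \<noteq> flip k P" "flip k P \<noteq> flip i (flip j P)"
    using flip_nth_neq[OF assms(1), of i] assms(2-) by (auto simp: vec_eq_iff)

lemma cuboid_nth: "x \<in> cuboid G \<longleftrightarrow> (\<forall>i. lo G $ i \<le> x $ i \<and> x $ i \<le> hi G $ i)"
  by (simp add: cuboid_def mem_box_cart)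

lemma verts_subset_cuboid: "V \<subseteq> cuboid G"
proof
  fix x assume x: "x \<in> V"
  show "x \<in> cuboid G"
    unfolding cuboid_nth
  proof
    fix i show "lo G $ i \<le> x $ i \<and> x $ i \<le> hi G $ i"
      using x lo_less_hi[of i] by (auto simp: verts_def dest!: spec[of _ i])
  qed
qed

lemma incident_iff: "incident G P Q \<longleftrightarrow> P \<in> V \<and> (\<exists>i. Q = flip i P)"
proof
  assume "incident G P Q"
  then obtain x y where xy: "{P, Q} = {x, y}" "x \<in> V" "y \<in> V" "card {i. x $ i \<noteq> y $ i} = 1"
    unfolding incident_def edges_def by auto
  obtain i where i: "{i. x $ i \<noteq> y $ i} = {i}" using xy(4) by (metis card_1_singletonE)
  have "y = flip i x"
    unfolding vec_eq_iff
  proof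
    fix m
    have "x $ m \<noteq> y $ m \<longleftrightarrow> m = i" using i by blast
    then show "y $ m = flip i x $ m"
      using verts_nth_cases[OF xy(2,3), of m] unfolding flip_nth by metis
  qed
  moreover have "x = flip i y" using calculation by simp
  ultimately show "P \<in> V \<and> (\<exists>i. Q = flip i P)"
    using xy(1-3) unfolding doubleton_eq_iff by blast
next
  assume "P \<in> V \<and> (\<exists>i. Q = flip i P)"
  then obtain i where i: "P \<in> V" "Q = flip i P" by auto
  have "{m. P $ m \<noteq> Q $ m} = {i}" using i flip_nth_neq[OF i(1), of i] by auto
  then show "incident G P Q" unfolding incident_def edges_def using i by fastforce
qed

lemma incident_commute: "incident G P Q \<longleftrightarrow> incident G Q P"
  by (simp add: incident_def insert_commute)

lemma incident_flip [simp]: "P \<in> V \<Longrightarrow> incident G P (flip i P)" "P \<in> V \<Longrightarrow> incident G (flip i P) P"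
  by (auto simp: incident_iff intro: exI[of _ i])

lemma not_incident_self [simp]: "\<not> incident G P P"
  unfolding incident_iff using flip_neq(2) by blast

lemma not_incident_diagonal:
  assumes "j \<noteq> k"
  shows "\<not> incident G P (flip j (flip k P))"
proof
  assume "incident G P (flip j (flip k P))"
  then obtain m where P: "P \<in> V" and m: "flip j (flip k P) = flip m P"
    by (auto simp: incident_iff)
  have "flip j (flip k P) $ j = flip m P $ j" "flip j (flip k P) $ k = flip m P $ k"
    using m by simp_all
  then show False
    using assms flip_nth_neq[OF P, of j] flip_nth_neq[OF P, of k] by (simp split: if_splits)
qed

lemma edge_iff: "{P, Q} \<in> edges G \<longleftrightarrow> P \<in> V \<and> (\<exists>i. Q = flip i P)"
  using incident_iff by (simp add: incident_def)

lemma edgeE: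
  assumes "e \<in> edges G"
  obtains P i where "P \<in> V" "e = {P, flip i P}"
proof -
  obtain P Q where "e = {P, Q}" using assms by (auto simp: edges_def)
  then show thesis using assms that by (auto simp: edge_iff)
qed

text \<open>Each coordinate of a node is that of \<open>P\<close> or its reflected value; the eight
  patterns are the facts \<open>e0\<close> to \<open>e7\<close>.\<close>

lemma verts_eq:
  assumes "P \<in> V" "i \<noteq> j" "i \<noteq> k" "j \<noteq> k"
  shows "V = {P, flip i P, flip j P, flip k P, flip i (flip j P), flip i (flip k P),
              flip j (flip k P), flip i (flip j (flip k P))}" (is "V = ?R")
proof
  show "V \<subseteq> ?R"
  proof
    fix Q assume Q: "Q \<in> V"
    have eq: "Q = R" if "Q $ i = R $ i" "Q $ j = R $ j" "Q $ k = R $ k" for R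
      unfolding vec_eq_iff
    proof
      fix m show "Q $ m = R $ m" using axis_cases[OF assms(2-), of m] that by (elim disjE) simp_all
    qed
    have e0: "Q = P"
      if "Q $ i = P $ i" "Q $ j = P $ j" "Q $ k = P $ k"
      by (rule eq) (use that assms(2-) in auto)
    have e1: "Q = flip i P"
      if "Q $ i = lo G $ i + hi G $ i - P $ i" "Q $ j = P $ j" "Q $ k = P $ k"
      by (rule eq) (use that assms(2-) in auto)
    have e2: "Q = flip j P"
      if "Q $ i = P $ i" "Q $ j = lo G $ j + hi G $ j - P $ j" "Q $ k = P $ k"
      by (rule eq) (use that assms(2-) in auto)
    have e3: "Q = flip i (flip j P)"
      if "Q $ i = lo G $ i + hi G $ i - P $ i" "Q $ j = lo G $ j + hi G $ j - P $ j" "Q $ k = P $ k"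
      by (rule eq) (use that assms(2-) in auto)
    have e4: "Q = flip k P"
      if "Q $ i = P $ i" "Q $ j = P $ j" "Q $ k = lo G $ k + hi G $ k - P $ k"
      by (rule eq) (use that assms(2-) in auto)
    have e5: "Q = flip i (flip k P)"
      if "Q $ i = lo G $ i + hi G $ i - P $ i" "Q $ j = P $ j" "Q $ k = lo G $ k + hi G $ k - P $ k"
      by (rule eq) (use that assms(2-) in auto)
    have e6: "Q = flip j (flip k P)"
      if "Q $ i = P $ i" "Q $ j = lo G $ j + hi G $ j - P $ j" "Q $ k = lo G $ k + hi G $ k - P $ k"
      by (rule eq) (use that assms(2-) in auto)
    have e7: "Q = flip i (flip j (flip k P))"
      if "Q $ i = lo G $ i + hi G $ i - P $ i" "Q $ j = lo G $ j + hi G $ j - P $ j" "Q $ k = lo G $ k + hi G $ k - P $ k"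
      by (rule eq) (use that assms(2-) in auto)
    show "Q \<in> ?R"
      using verts_nth_cases[OF assms(1) Q, of i] verts_nth_cases[OF assms(1) Q, of j]
        verts_nth_cases[OF assms(1) Q, of k] e0 e1 e2 e3 e4 e5 e6 e7 by blast
  qed
qed (use assms in auto)

lemma face_verts:
  assumes "P \<in> V" "i \<noteq> j" "i \<noteq> k" "j \<noteq> k"
  shows "face i P \<inter> V = {P, flip j P, flip k P, flip j (flip k P)}"
proof -
  have *: "Q \<in> face i P \<inter> V \<longleftrightarrow> Q \<in> V \<and> Q $ i = P $ i" for Q
    unfolding face_def using verts_subset_cuboid by blast
  show ?thesis
  proof (intro equalityI subsetI)
    fix Q assume "Q \<in> face i P \<inter> V"
    then have "Q \<in> V" "Q $ i = P $ i" unfolding * by auto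
    then show "Q \<in> {P, flip j P, flip k P, flip j (flip k P)}"
      using assms(2-4) flip_nth_neq[OF assms(1), of i] unfolding verts_eq[OF assms]
      by (elim insertE emptyE) simp_all
  qed (unfold *, use assms in auto)
qed

lemma face_cong: "Q $ i = P $ i \<Longrightarrow> face i Q = face i P"
  by (simp add: face_def)

lemma faces_eq: "faces G = {face i P | i P. P \<in> V}"
proof -
  have lohi: "lo G \<in> V" "hi G \<in> V" by (auto simp: verts_def)
  show ?thesis
  proof (intro equalityI subsetI)
    fix S assume "S \<in> faces G"
    then obtain i s where S: "S = {x \<in> cuboid G. x $ i = s}" "s = lo G $ i \<or> s = hi G $ i"
      unfolding faces_def by blast
    then have "S = face i (lo G) \<or> S = face i (hi G)" by (auto simp: face_def)
    then show "S \<in> {face i P | i P. P \<in> V}" using lohi by blast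
  next
    fix S assume "S \<in> {face i P | i P. P \<in> V}"
    then obtain i P where S: "S = face i P" "P \<in> V" by blast
    then have "P $ i = lo G $ i \<or> P $ i = hi G $ i" by (simp add: verts_def)
    then show "S \<in> faces G" unfolding S(1) face_def faces_def by blast
  qed
qed

lemma face_in_faces [simp]: "P \<in> V \<Longrightarrow> face i P \<in> faces G"
  by (auto simp: faces_eq)

lemma in_face: "P \<in> V \<Longrightarrow> P \<in> face i P"
  using verts_subset_cuboid by (auto simp: face_def)

section \<open>Disperse and continuous nodes, and L-faces in a frame\<close>

lemma C_iff: "P \<in> C \<longleftrightarrow> P \<in> V \<and> P \<notin> D"
  by (auto simp: disperse_nodes_def continuous_nodes_def)

lemma D_verts: "P \<in> D \<Longrightarrow> P \<in> V"
  by (auto simp: disperse_nodes_def)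

lemma finite_verts [simp]: "finite V"
  using verts_eq[of "lo G" 1 2 3] by (simp add: verts_def)

text \<open>Nodes correspond bijectively to the sets of axes in which the upper coordinate is
  taken.\<close>

lemma card_verts: "card V = 8"
proof -
  let ?f = "\<lambda>A. (\<chi> m. if m \<in> A then hi G $ m else lo G $ m) :: real^3"
  have "inj ?f"
    by (rule injI) (use lo_less_hi in \<open>auto simp: vec_eq_iff split: if_splits; metis less_irrefl\<close>)
  moreover have "V = range ?f"
  proof
    show "V \<subseteq> range ?f"
    proof
      fix x assume "x \<in> V"
      then have "x = ?f {m. x $ m = hi G $ m}" by (auto simp: verts_def vec_eq_iff)
      then show "x \<in> range ?f" by blast
    qed
  qed (auto simp: verts_def)
  ultimately have "card V = card (UNIV :: 3 set set)" by (simp add: card_image)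
  also have "\<dots> = 8" by (simp add: card_Pow flip: Pow_UNIV)
  finally show ?thesis .
qed

text \<open>For a disperse node \<open>P\<close> of the face, non-incidence makes both neighbours of
  \<open>P\<close> in the face continuous, so the second disperse node is the diagonal one.\<close>

lemma L_face_iff:
  "S \<in> L_faces c G \<longleftrightarrow> (\<exists>P i j k. i \<noteq> j \<and> i \<noteq> k \<and> j \<noteq> k \<and> S = face i P \<and> P \<in> D \<and>
     flip j (flip k P) \<in> D \<and> flip j P \<in> C \<and> flip k P \<in> C)" (is "_ \<longleftrightarrow> ?R")
proof
  assume S: "S \<in> L_faces c G"
  then obtain i P0 where S1: "S = face i P0" "P0 \<in> V" by (auto simp: L_faces_def faces_eq)
  have card: "card (S \<inter> D) = 2" using S by (simp add: L_faces_def)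
  then obtain P where P: "P \<in> S" "P \<in> D" by (metis IntE all_not_in_conv card.empty zero_neq_numeral)
  have PV: "P \<in> V" using P D_verts by auto
  have SP: "S = face i P" using P S1 by (auto simp: face_def)
  obtain j k where ijk: "i \<noteq> j" "i \<noteq> k" "j \<noteq> k" by (rule obtain_axes)
  have nodes: "S \<inter> V = {P, flip j P, flip k P, flip j (flip k P)}"
    unfolding SP by (rule face_verts[OF PV ijk])
  have no: "Q \<notin> D" if "Q \<in> S" "incident G P Q" for Q
    using S P that by (auto simp: L_faces_def)
  have jk: "flip j P \<notin> D" "flip k P \<notin> D"
    using no[of "flip j P"] no[of "flip k P"] nodes PV incident_flip by blast+
  have "flip j (flip k P) \<in> D"
  proof (rule ccontr)
    assume "flip j (flip k P) \<notin> D"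
    then have "S \<inter> D \<subseteq> {P}" using nodes jk D_verts by blast
    then show False using card card_mono[of "{P}" "S \<inter> D"] by simp
  qed
  then show ?R using SP P jk ijk PV C_iff by auto
next
  assume ?R
  then obtain P i j k where *: "i \<noteq> j" "i \<noteq> k" "j \<noteq> k" "S = face i P" "P \<in> D"
     "flip j (flip k P) \<in> D" "flip j P \<in> C" "flip k P \<in> C" by blast
  have PV: "P \<in> V" using * D_verts by auto
  have nodes: "S \<inter> V = {P, flip j P, flip k P, flip j (flip k P)}"
    unfolding * by (rule face_verts[OF PV *(1-3)])
  have notD: "flip j P \<notin> D" "flip k P \<notin> D" "P \<notin> C" "flip j (flip k P) \<notin> C"
    using *(5-8) C_iff by blast+
  have "S \<inter> D = (S \<inter> V) \<inter> D" "S \<inter> C = (S \<inter> V) \<inter> C" using D_verts C_iff by blast+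
  then have SD: "S \<inter> D = {P, flip j (flip k P)}" and SC: "S \<inter> C = {flip j P, flip k P}"
    using notD *(5-8) unfolding nodes by simp_all
  have "\<not> incident G (flip j (flip k P)) P" "\<not> incident G P (flip j (flip k P))"
    using not_incident_diagonal[OF *(3), of P] incident_commute by blast+
  then have "\<forall>Q\<in>S \<inter> D. \<forall>R\<in>S \<inter> D. \<not> incident G Q R"
    unfolding SD by simp
  moreover have "card (S \<inter> D) = 2" "card (S \<inter> C) = 2"
    unfolding SD SC using PV *(3) by simp_all
  moreover have "S \<in> faces G" using *(4) PV by simp
  ultimately show "S \<in> L_faces c G" unfolding L_faces_def by blast
qed

text \<open>In this form the absence of L-faces connects two diagonal disperse nodes of a face along
  disperse edges.\<close>

lemma no_L_face:
  assumes "L_faces c G = {}" "j \<noteq> k" "P \<in> D" "flip j (flip k P) \<in> D"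
  shows "flip j P \<in> D \<or> flip k P \<in> D"
proof -
  obtain i where "j \<noteq> i" "k \<noteq> i" by (rule obtain_third_axis[OF assms(2)])
  then have "i \<noteq> j" "i \<noteq> k" by auto
  then have "\<not> (flip j P \<in> C \<and> flip k P \<in> C)" using assms L_face_iff by blast
  then show ?thesis using assms D_verts C_iff by auto
qed

section \<open>Iso-points\<close>


text \<open>The continuous end point comes first, so each edge with end points of both kinds is
  described by exactly one pair \<open>x\<close>, \<open>i\<close>.\<close>

definition cut :: "real^3 \<Rightarrow> 3 \<Rightarrow> bool" where
  "cut x i \<longleftrightarrow> x \<in> C \<and> flip i x \<in> D"

abbreviation pt :: "real^3 \<Rightarrow> 3 \<Rightarrow> real^3" where
  "pt x i \<equiv> iso_point c G x (flip i x)"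

lemma cut_vert: "cut x i \<Longrightarrow> x \<in> V"
  by (simp add: cut_def C_iff)

lemma pt_nth_other: "m \<noteq> i \<Longrightarrow> pt x i $ m = x $ m"
  by (simp add: iso_point_def)

text \<open>\<open>t\<close> is the interpolation weight. It is less than 1 because a disperse label
  exceeds \<open>c\<close> strictly, so an iso-point may coincide with the continuous end of its
  edge but never with the disperse one.\<close>

lemma pt_nth:
  assumes "cut x i"
  obtains t where "0 \<le> t" "t < 1" "t = 0 \<longleftrightarrow> label G x = c"
    "pt x i $ i = (1 - t) * x $ i + t * flip i x $ i"
proof
  let ?t = "(c - label G x) / (label G (flip i x) - label G x)"
  have l: "label G x \<le> c" "c < label G (flip i x)"
    using assms by (auto simp: cut_def disperse_nodes_def continuous_nodes_def)
  show "0 \<le> ?t" "?t < 1" "?t = 0 \<longleftrightarrow> label G x = c" using l by auto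
  have "pt x i $ i = x $ i + ?t * (flip i x $ i - x $ i)" by (simp add: iso_point_def)
  also have "\<dots> = (1 - ?t) * x $ i + ?t * flip i x $ i" by algebra
  finally show "pt x i $ i = (1 - ?t) * x $ i + ?t * flip i x $ i" .
qed

lemma pt_nth_neq_flip:
  assumes "cut x i"
  shows "pt x i $ i \<noteq> flip i x $ i"
proof
  obtain t where t: "t < 1" "pt x i $ i = (1 - t) * x $ i + t * flip i x $ i"
    using pt_nth[OF assms] by metis
  assume "pt x i $ i = flip i x $ i"
  then have "(1 - t) * (x $ i - flip i x $ i) = 0" using t by argo
  then have "x $ i = flip i x $ i" using t by simp
  then show False using flip_nth_neq[OF cut_vert[OF assms], of i] by simp
qed

lemma pt_nth_eq_iff:
  assumes "cut x i"
  shows "pt x i $ i = x $ i \<longleftrightarrow> label G x = c"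
proof -
  obtain t where t: "t = 0 \<longleftrightarrow> label G x = c" "pt x i $ i = (1 - t) * x $ i + t * flip i x $ i"
    using pt_nth[OF assms] by metis
  have "pt x i $ i = x $ i \<longleftrightarrow> t * (flip i x $ i - x $ i) = 0" using t(2) by argo
  also have "\<dots> \<longleftrightarrow> t = 0" using flip_nth_neq[OF cut_vert[OF assms], of i] by auto
  finally show ?thesis using t(1) by simp
qed

lemma pt_corner: "cut x i \<Longrightarrow> label G x = c \<Longrightarrow> pt x i = x"
  by (simp add: iso_point_def)

lemma pt_in_cuboid:
  assumes "cut x i"
  shows "pt x i \<in> cuboid G"
  unfolding cuboid_nth
proof
  fix m
  obtain t where t: "0 \<le> t" "t < 1" "pt x i $ i = (1 - t) * x $ i + t * flip i x $ i"
    using pt_nth[OF assms] by metis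
  have x: "lo G $ m \<le> x $ m" "x $ m \<le> hi G $ m"
    and f: "lo G $ m \<le> flip i x $ m" "flip i x $ m \<le> hi G $ m"
    using verts_subset_cuboid cut_vert[OF assms] flip_in_verts[of i x] unfolding cuboid_nth subset_eq by blast+
  show "lo G $ m \<le> pt x i $ m \<and> pt x i $ m \<le> hi G $ m"
  proof (cases "m = i")
    case True
    have "convex {lo G $ m..hi G $ m}" by simp
    from convexD[OF this, of "x $ m" "flip i x $ m" "1 - t" t] show ?thesis
      using x f t True by auto
  qed (use x pt_nth_other in auto)
qed

text \<open>Along its own edge an iso-point reaches an extreme coordinate only at the continuous
  end; this is the degenerate case of an iso-node.\<close>

lemma pt_extremal:
  assumes "cut x i" "v \<in> V" "pt x i $ i = v $ i"
  shows "label G x = c" "pt x i = x"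
proof -
  have "v $ i = x $ i \<or> v $ i = flip i x $ i"
    using verts_nth_cases[OF cut_vert[OF assms(1)] assms(2), of i] by simp
  then show "label G x = c" using assms pt_nth_neq_flip pt_nth_eq_iff by metis
  then show "pt x i = x" using pt_corner assms by simp
qed

lemma pt_in_vertsD:
  assumes "cut x i" "pt x i \<in> V"
  shows "label G x = c" "pt x i = x"
  using pt_extremal[OF assms] by auto

lemma iso_points_iff: "p \<in> iso_points c G \<longleftrightarrow> (\<exists>x i. cut x i \<and> p = pt x i)"
proof
  assume "p \<in> iso_points c G"
  then obtain x0 x1 where x: "p = iso_point c G x0 x1" "{x0, x1} \<in> edges G"
    "label G x0 \<le> c" "c < label G x1"
    unfolding iso_points_def by blast
  obtain i where i: "x0 \<in> V" "x1 = flip i x0" using x(2) unfolding edge_iff by blast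
  then have "cut x0 i" using x by (simp add: cut_def disperse_nodes_def continuous_nodes_def)
  then show "\<exists>x i. cut x i \<and> p = pt x i" using x i by blast
next
  assume "\<exists>x i. cut x i \<and> p = pt x i"
  then obtain x i where "cut x i" "p = pt x i" by blast
  then show "p \<in> iso_points c G"
    unfolding iso_points_def using edge_iff[of x "flip i x"]
    by (auto simp: cut_def disperse_nodes_def continuous_nodes_def)
qed

section \<open>Iso-points on faces and edges\<close>

lemma face_iso_points_iff:
  "p \<in> face_iso_points c G S \<longleftrightarrow> (\<exists>x i. cut x i \<and> x \<in> S \<and> flip i x \<in> S \<and> p = pt x i)"
proof
  assume "p \<in> face_iso_points c G S"
  then obtain x0 x1 where x: "p = iso_point c G x0 x1" "{x0, x1} \<in> edges G" "x0 \<in> S" "x1 \<in> S"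
    "label G x0 \<le> c" "c < label G x1"
    unfolding face_iso_points_def by blast
  obtain i where i: "x0 \<in> V" "x1 = flip i x0" using x(2) unfolding edge_iff by blast
  then have "cut x0 i" using x by (simp add: cut_def disperse_nodes_def continuous_nodes_def)
  then show "\<exists>x i. cut x i \<and> x \<in> S \<and> flip i x \<in> S \<and> p = pt x i" using x i by blast
next
  assume "\<exists>x i. cut x i \<and> x \<in> S \<and> flip i x \<in> S \<and> p = pt x i"
  then obtain x i where "cut x i" "p = pt x i" "x \<in> S" "flip i x \<in> S" by blast
  moreover from this have "x \<in> V" "label G x \<le> c" "c < label G (flip i x)"
    by (auto simp: cut_def disperse_nodes_def continuous_nodes_def)
  moreover have "{x, flip i x} \<in> edges G" using calculation by (auto simp: edge_iff)
  ultimately show "p \<in> face_iso_points c G S"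
    unfolding face_iso_points_def by blast
qed

lemma face_iso_points_subset: "face_iso_points c G S \<subseteq> iso_points c G"
  unfolding subset_iff face_iso_points_iff iso_points_iff by blast

lemma finite_iso_points [simp]: "finite (iso_points c G)"
proof -
  have "iso_points c G \<subseteq> (\<lambda>(x, i). pt x i) ` (V \<times> UNIV)"
    unfolding subset_iff iso_points_iff using cut_vert by force
  then show ?thesis by (rule finite_subset) simp
qed

lemma iso_nodes_iff: "x \<in> iso_nodes c G \<longleftrightarrow> label G x = c \<and> (\<exists>i. cut x i)"
proof
  assume "x \<in> iso_nodes c G"
  then have "x \<in> V" "x \<in> iso_points c G" by (simp_all add: iso_nodes_def)
  then obtain y i where "cut y i" "x = pt y i" "x \<in> V" unfolding iso_points_iff by blast
  then show "label G x = c \<and> (\<exists>i. cut x i)" using pt_in_vertsD[of y i] by auto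
next
  assume "label G x = c \<and> (\<exists>i. cut x i)"
  then show "x \<in> iso_nodes c G" unfolding iso_nodes_def iso_points_iff
    using cut_vert pt_corner by (metis IntI iso_points_iff)
qed

lemma iso_point_in_cuboid: "p \<in> iso_points c G \<Longrightarrow> p \<in> cuboid G"
  using pt_in_cuboid by (auto simp: iso_points_iff)

lemma iso_point_vert:
  assumes "p \<in> iso_points c G" "p \<in> V"
  shows "label G p = c" "p \<in> C"
proof -
  have "p \<in> iso_nodes c G" using assms by (simp add: iso_nodes_def)
  then show "label G p = c" "p \<in> C" by (auto simp: iso_nodes_iff cut_def)
qed

lemma face_iso_points_nth:
  assumes "p \<in> face_iso_points c G (face i v)"
  shows "p $ i = v $ i"
proof -
  obtain x a where x: "cut x a" "x \<in> face i v" "flip a x \<in> face i v" "p = pt x a"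
    using assms unfolding face_iso_points_iff by blast
  have "a \<noteq> i" using x(2,3) flip_nth_neq[OF cut_vert[OF x(1)], of i] by (auto simp: face_def)
  then show ?thesis using x pt_nth_other[of i a x] by (simp add: face_def)
qed

lemma verts_ridge:
  assumes "x \<in> V" "y \<in> V" "x $ i = y $ i" "x $ j = y $ j" "i \<noteq> j" "i \<noteq> n" "j \<noteq> n"
  shows "y = x \<or> y = flip n x"
proof -
  have eq: "y = z" if "y $ n = z $ n" "z $ i = x $ i" "z $ j = x $ j" for z
    unfolding vec_eq_iff
  proof
    fix m show "y $ m = z $ m"
      using axis_cases[OF assms(5-7), of m] that assms(3,4) by (elim disjE) simp_all
  qed
  have "y = x" if "y $ n = x $ n" using eq[OF that] by simp
  moreover have "y = flip n x" if "y $ n = flip n x $ n"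
    using eq[OF that] assms(6,7) by simp
  ultimately show ?thesis using verts_nth_cases[OF assms(1,2), of n] by auto
qed

text \<open>An edge carries at most one iso-point of its own, and then no end point is an iso-point
  on account of another edge.\<close>

lemma iso_points_on_edge:
  assumes "p \<in> iso_points c G" "q \<in> iso_points c G" "p \<noteq> q" "i \<noteq> j" "v \<in> V"
    and "p $ i = v $ i" "q $ i = v $ i" "p $ j = v $ j" "q $ j = v $ j"
  shows "p \<in> V \<and> q \<in> V"
proof -
  obtain k where k: "i \<noteq> k" "j \<noteq> k" by (rule obtain_third_axis[OF assms(4)])
  have key: "p \<in> V" if pq: "p \<in> iso_points c G" "q \<in> iso_points c G" "p \<noteq> q"
    "p $ i = v $ i" "q $ i = v $ i" "p $ j = v $ j" "q $ j = v $ j" for p q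
  proof (rule ccontr)
    assume no: "p \<notin> V"
    obtain x a where x: "cut x a" "p = pt x a" using pq unfolding iso_points_iff by blast
    obtain y b where y: "cut y b" "q = pt y b" using pq unfolding iso_points_iff by blast
    \<comment> \<open>An edge along \<open>i\<close> or \<open>j\<close> would put \<open>p\<close>
      at an extreme coordinate of that edge and make it a node.\<close>
    have "\<not> (a = i \<or> a = j)"
      using x no pq(4,6) pt_extremal[OF x(1) assms(5)] cut_vert[OF x(1)] by metis
    then have a: "a = k" using axis_cases[OF assms(4) k, of a] by blast
    have xV: "x \<in> V" and yV: "y \<in> V" using cut_vert x y by auto
    have xv: "x $ i = v $ i" "x $ j = v $ j" using pq(4,6) x(2) k a pt_nth_other[of i a x] pt_nth_other[of j a x] by simp_all
    have "y $ m = v $ m" if "q $ m = v $ m" for m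
    proof (cases "b = m")
      case True
      then show ?thesis using pt_extremal(2)[OF y(1) assms(5)] that y(2) by simp
    next
      case False
      then show ?thesis using pt_nth_other[of m b y] that y(2) by simp
    qed
    then have yv: "y $ i = v $ i" "y $ j = v $ j" using pq(5,7) by simp_all
    have "y = x \<or> y = flip k x"
      using verts_ridge[OF xV yV _ _ assms(4) k] xv yv by simp
    moreover have "y \<in> C" "flip k x \<notin> C" using x y a by (auto simp: cut_def C_iff)
    ultimately have yx: "y = x" by metis
    \<comment> \<open>Both edges start at \<open>x\<close>, so equal axes would give
      \<open>p = q\<close>. With another axis \<open>q\<close> is the node \<open>x\<close>, which
      then has label \<open>c\<close>, and so \<open>p\<close> is a node too.\<close>
    have "b \<noteq> k" using yx x y a pq by metis
    then have "b = i \<or> b = j" using axis_cases[OF assms(4) k, of b] by blast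
    then have "label G x = c" using pt_extremal(1)[OF y(1) assms(5)] y pq yx by metis
    then show False using no x xV pt_corner by simp
  qed
  show ?thesis using key[of p q] key[of q p] assms by auto
qed

lemma in_face_iff: "x \<in> V \<Longrightarrow> x \<in> face i v \<longleftrightarrow> x $ i = v $ i"
  using verts_subset_cuboid by (auto simp: face_def)

lemma flip_in_face: "x \<in> V \<Longrightarrow> flip a x \<in> face i x \<longleftrightarrow> a \<noteq> i"
  using flip_nth_neq[of x i] in_face_iff[of "flip a x"] by auto

text \<open>A node with label \<open>c\<close> among three disperse ones has a disperse neighbour in
  the face and so is an iso-node. Conversely an iso-node is continuous, hence it is the one node
  left by three disperse ones.\<close>

lemma singular_face_iff:
  assumes "S \<in> faces G"
  shows "singular_face c G S \<longleftrightarrow> (\<exists>x\<in>S \<inter> V. label G x = c \<and> S \<inter> V - {x} \<subseteq> D)"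
proof -
  obtain i v where S: "S = face i v" and vV: "v \<in> V" using assms by (auto simp: faces_eq)
  obtain j k where ijk: "i \<noteq> j" "i \<noteq> k" "j \<noteq> k" by (rule obtain_axes)
  have nodes: "S \<inter> V = {v, flip j v, flip k v, flip j (flip k v)}"
    unfolding S by (rule face_verts[OF vV ijk])
  have card4: "card (S \<inter> V) = 4" using nodes vV ijk by simp
  have fin: "finite (S \<inter> V)" by simp
  have SD: "S \<inter> D \<subseteq> S \<inter> V" using D_verts by blast
  show ?thesis
  proof
    assume s: "singular_face c G S"
    have "card (S \<inter> V - S \<inter> D) = 1"
      using s card4 SD fin by (simp add: singular_face_def card_Diff_subset finite_subset)
    then obtain x where x: "S \<inter> V - S \<inter> D = {x}" by (rule card_1_singletonE)
    obtain y where y: "S \<inter> iso_nodes c G = {y}" using s unfolding singular_face_def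
      by (metis card_1_singletonE)
    have "y \<in> S" "label G y = c" "y \<in> C" using y by (auto simp: iso_nodes_iff cut_def)
    then have "y = x" using x C_iff by blast
    then show "\<exists>x\<in>S \<inter> V. label G x = c \<and> S \<inter> V - {x} \<subseteq> D"
      using \<open>label G y = c\<close> x by blast
  next
    assume "\<exists>x\<in>S \<inter> V. label G x = c \<and> S \<inter> V - {x} \<subseteq> D"
    then obtain x where x: "x \<in> S" "x \<in> V" "label G x = c" "S \<inter> V - {x} \<subseteq> D" by blast
    have xD: "x \<notin> D" using x by (simp add: disperse_nodes_def)
    then have "S \<inter> D = S \<inter> V - {x}" using x SD by blast
    then have c3: "card (S \<inter> D) = 3" using x card4 by simp
    have "S = face i x" using x(1) S by (auto simp: face_def)
    then have "flip j x \<in> S" using flip_in_face[OF x(2), of j i] ijk by auto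
    then have "flip j x \<in> D" using x by auto
    then have "x \<in> iso_nodes c G" using x xD C_iff by (auto simp: iso_nodes_iff cut_def)
    moreover have "iso_nodes c G \<inter> D = {}" by (auto simp: iso_nodes_iff disperse_nodes_def)
    moreover have "iso_nodes c G \<subseteq> V" by (auto simp: iso_nodes_def)
    ultimately have "S \<inter> iso_nodes c G = {x}" using x by blast
    then show "singular_face c G S" using c3 assms by (simp add: singular_face_def)
  qed
qed

lemma face_iso_points_frame:
  assumes "v \<in> V" "i \<noteq> j" "i \<noteq> k" "j \<noteq> k"
  shows "p \<in> face_iso_points c G (face i v) \<longleftrightarrow>
    (\<exists>x\<in>{v, flip j v, flip k v, flip j (flip k v)}. \<exists>a\<in>{j, k}. cut x a \<and> p = pt x a)"
proof -
  have "flip a x \<in> face i v \<longleftrightarrow> a \<noteq> i" if "x \<in> face i v" "x \<in> V" for a x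
  proof -
    have "face i v = face i x" using that by (auto simp: face_def)
    then show ?thesis using flip_in_face that by simp
  qed
  moreover have "a \<noteq> i \<longleftrightarrow> a \<in> {j, k}" for a using axis_cases[OF assms(2-), of a] assms by auto
  ultimately have "p \<in> face_iso_points c G (face i v) \<longleftrightarrow>
    (\<exists>x\<in>face i v \<inter> V. \<exists>a\<in>{j, k}. cut x a \<and> p = pt x a)"
    unfolding face_iso_points_iff using cut_vert by blast
  then show ?thesis unfolding face_verts[OF assms] .
qed

text \<open>Relative to a continuous node \<open>v\<close> the other three nodes have eight
  colourings; the continuous face and the L-face drop out. Each of the remaining six has exactly two
  cut edges, and one coordinate separates their iso-points.\<close>

lemma regular_face_iso_points:
  assumes "regular_face c G S"
  shows "\<exists>p q. p \<noteq> q \<and> face_iso_points c G S = {p, q}"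
proof -
  have S: "S \<in> faces G" "S \<notin> L_faces c G" "\<not> S \<inter> V \<subseteq> D" "\<not> S \<inter> V \<subseteq> C" "\<not> singular_face c G S"
    using assms by (auto simp: regular_face_def disperse_face_def continuous_face_def)
  obtain i v0 where "S = face i v0" using S by (auto simp: faces_eq)
  moreover obtain v where v: "v \<in> S" "v \<in> V" "v \<notin> D" using S by blast
  ultimately have Sv: "S = face i v" by (auto simp: face_def)
  obtain j k where ijk: "i \<noteq> j" "i \<noteq> k" "j \<noteq> k" by (rule obtain_axes)
  let ?w = "flip j (flip k v)"
  have nodes: "S \<inter> V = {v, flip j v, flip k v, ?w}"
    unfolding Sv by (rule face_verts[OF v(2) ijk])
  have fip: "face_iso_points c G S = {p. \<exists>x\<in>{v, flip j v, flip k v, ?w}. \<exists>a\<in>{j, k}. cut x a \<and> p = pt x a}"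
    unfolding Sv using face_iso_points_frame[OF v(2) ijk] by blast
  have w: "flip k (flip j v) = ?w" "flip j ?w = flip k v" "flip k ?w = flip j v"
    by (simp_all add: flip_commute)
  have nth: "cut x a \<Longrightarrow> pt x a $ a \<noteq> flip a x $ a" "m \<noteq> a \<Longrightarrow> pt x a $ m = x $ m" for x a m
    using pt_nth_neq_flip pt_nth_other by auto
  have neq: "x \<noteq> y" if "x $ m \<noteq> y $ m" for x y :: "real^3" and m using that by auto
  have vn: "v $ a \<noteq> flip a v $ a" for a using flip_nth_neq[OF v(2), of a] by simp
  have L: "\<not> (flip j v \<in> D \<and> flip k v \<in> D \<and> ?w \<notin> D)"
  proof
    assume a: "flip j v \<in> D \<and> flip k v \<in> D \<and> ?w \<notin> D"
    have "S = face i (flip j v)" using Sv ijk by (simp add: face_def)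
    then have "S \<in> L_faces c G"
      unfolding L_face_iff using a ijk v w C_iff
        by (intro exI[of _ "flip j v"] exI[of _ i] exI[of _ j] exI[of _ k]) (simp add: flip_commute)
    then show False using S by simp
  qed
  have sing: "\<not> (flip j v \<in> D \<and> flip k v \<in> D \<and> ?w \<in> D \<and> label G v = c)"
    using S(5) v nodes unfolding singular_face_iff[OF S(1)] by blast
  have cont: "flip j v \<in> D \<or> flip k v \<in> D \<or> ?w \<in> D"
    using S(4) nodes C_iff v by auto
  have cut: "cut v j \<longleftrightarrow> flip j v \<in> D" "cut v k \<longleftrightarrow> flip k v \<in> D"
    "cut (flip j v) j \<longleftrightarrow> False" "cut (flip k v) k \<longleftrightarrow> False"
    "cut (flip j v) k \<longleftrightarrow> flip j v \<notin> D \<and> ?w \<in> D" "cut (flip k v) j \<longleftrightarrow> flip k v \<notin> D \<and> ?w \<in> D"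
    "cut ?w j \<longleftrightarrow> ?w \<notin> D \<and> flip k v \<in> D" "cut ?w k \<longleftrightarrow> ?w \<notin> D \<and> flip j v \<in> D"
    using v w by (auto simp: cut_def C_iff)
  consider (a) "flip j v \<notin> D" "flip k v \<notin> D" "?w \<in> D"
    | (b) "flip j v \<notin> D" "flip k v \<in> D" "?w \<notin> D" | (c) "flip j v \<notin> D" "flip k v \<in> D" "?w \<in> D"
    | (d) "flip j v \<in> D" "flip k v \<notin> D" "?w \<notin> D" | (e) "flip j v \<in> D" "flip k v \<notin> D" "?w \<in> D"
    | (f) "flip j v \<in> D" "flip k v \<in> D" "?w \<in> D" "label G v \<noteq> c"
    using L sing cont by blast
  then show ?thesis
  proof cases
    case a
    have "pt (flip j v) k $ k \<noteq> pt (flip k v) j $ k"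
      using nth(1)[of "flip j v" k] nth(2)[of k j "flip k v"] cut a ijk w by simp
    moreover have "face_iso_points c G S = {pt (flip j v) k, pt (flip k v) j}"
      unfolding fip using a ijk by (auto simp: cut)
    ultimately show ?thesis using neq by blast
  next
    case b
    have "pt v k $ j \<noteq> pt ?w j $ j"
      using nth(1)[of ?w j] nth(2)[of j k v] cut b ijk w by simp
    moreover have "face_iso_points c G S = {pt v k, pt ?w j}"
      unfolding fip using b ijk by (auto simp: cut)
    ultimately show ?thesis using neq by blast
  next
    case c
    have "pt v k $ j \<noteq> pt (flip j v) k $ j"
      using nth(2)[of j k v] nth(2)[of j k "flip j v"] vn[of j] ijk by simp
    moreover have "face_iso_points c G S = {pt v k, pt (flip j v) k}"
      unfolding fip using c ijk by (auto simp: cut)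
    ultimately show ?thesis using neq by blast
  next
    case d
    have "pt v j $ k \<noteq> pt ?w k $ k"
      using nth(1)[of ?w k] nth(2)[of k j v] cut d ijk w by simp
    moreover have "face_iso_points c G S = {pt v j, pt ?w k}"
      unfolding fip using d ijk by (auto simp: cut)
    ultimately show ?thesis using neq by blast
  next
    case e
    have "pt v j $ k \<noteq> pt (flip k v) j $ k"
      using nth(2)[of k j v] nth(2)[of k j "flip k v"] vn[of k] ijk by simp
    moreover have "face_iso_points c G S = {pt v j, pt (flip k v) j}"
      unfolding fip using e ijk by (auto simp: cut)
    ultimately show ?thesis using neq by blast
  next
    \<comment> \<open>Both cut edges start at \<open>v\<close>; their iso-points would coincide only
      if \<open>v\<close> had label \<open>c\<close>, which is the singular face.\<close>
    case f
    have "pt v j $ j \<noteq> pt v k $ j"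
      using pt_nth_eq_iff[of v j] nth(2)[of j k v] cut f ijk by simp
    moreover have "face_iso_points c G S = {pt v j, pt v k}"
      unfolding fip using f ijk by (auto simp: cut)
    ultimately show ?thesis using neq by blast
  qed
qed

section \<open>Iso-lines\<close>


text \<open>The common shape of T1-subgraphs and of the members of \<open>g1_subgraphs\<close> and
  \<open>g3_subgraphs\<close>, which differ only in the labels required.\<close>

definition star :: "real^3 \<Rightarrow> cuboid_subgraph" where
  "star P = \<lparr>sverts = insert P {Q. incident G P Q}, sedges = {{P, Q} | Q. incident G P Q},
     slabel = restrict (label G) (insert P {Q. incident G P Q})\<rparr>"

lemma star_simps [simp]:
  "sverts (star P) = insert P {Q. incident G P Q}"
  "sedges (star P) = {{P, Q} | Q. incident G P Q}"
  by (simp_all add: star_def)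

lemma subgraph_star:
  assumes "P \<in> V"
  shows "subgraph (star P) G"
proof -
  have "incident G P (flip 1 P)" using assms by simp
  moreover have "Q \<in> V" if "incident G P Q" for Q using that by (auto simp: incident_iff)
  ultimately show ?thesis using assms unfolding subgraph_def by (auto simp: star_def incident_def)
qed

lemma T1_free:
  assumes noT1: "\<nexists>H. T1_subgraph c G H" and x: "x \<in> V" "label G x = c"
  obtains m where "flip m x \<in> C"
proof -
  have "\<not> T1_subgraph c G (star x)" using noT1 by blast
  then have "\<not> {Q. incident G x Q} \<subseteq> D"
    unfolding T1_subgraph_def using x subgraph_star by auto
  then obtain Q where "incident G x Q" "Q \<notin> D" by blast
  then obtain m where "flip m x \<notin> D" by (auto simp: incident_iff)
  then show thesis using that[of m] x C_iff by simp
qed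

text \<open>Otherwise deleting \<open>z\<close> would leave a T2-subgraph: every remaining node has
  a neighbour other than \<open>z\<close> and so stays an end point of an edge.\<close>

lemma T2_free:
  assumes noT2: "\<nexists>H. T2_subgraph c G H" and x: "x \<in> V" "label G x = c" "label G (flip m x) = c"
    and z: "z \<in> V" "z \<noteq> x" "z \<noteq> flip m x"
  shows "\<not> V - {x, flip m x, z} \<subseteq> D"
proof
  assume D: "V - {x, flip m x, z} \<subseteq> D"
  define W where "W = V - {z}"
  define H where "H = \<lparr>sverts = W, sedges = {e \<in> edges G. e \<subseteq> W}, slabel = restrict (label G) W\<rparr>"
  have "\<exists>e\<in>sedges H. P \<in> e" if P: "P \<in> W" for P
  proof -
    have PV: "P \<in> V" using P by (simp add: W_def)
    obtain j k :: 3 where "j \<noteq> k" using obtain_axes by metis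
    then have "flip j P \<noteq> flip k P" using PV by simp
    then obtain a where "flip a P \<noteq> z" by metis
    then have "{P, flip a P} \<in> sedges H" using P PV by (auto simp: H_def W_def edge_iff)
    then show ?thesis by blast
  qed
  then have "subgraph H G" by (auto simp: subgraph_def H_def W_def)
  moreover have "card (sverts H) = 7" using z card_verts by (simp add: H_def W_def)
  moreover have "x \<in> sverts H" "flip m x \<in> sverts H" "incident G x (flip m x)"
    using x z by (auto simp: H_def W_def)
  moreover have "sverts H - {x, flip m x} \<subseteq> D" using D by (auto simp: H_def W_def)
  ultimately have "T2_subgraph c G H"
    using x unfolding T2_subgraph_def by blast
  then show False using noT2 by blast
qed

text \<open>End points of both kinds exclude disperse and continuous faces; in a singular face
  \<open>x\<close> would be the only continuous node and have label \<open>c\<close>.\<close>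

lemma regular_faceI:
  assumes noL: "L_faces c G = {}" and x: "x \<in> C" "flip a x \<in> D" "a \<noteq> m"
    and y: "label G x \<noteq> c \<or> (\<exists>y\<in>face m x. y \<noteq> x \<and> y \<in> C)"
  shows "regular_face c G (face m x)"
proof -
  have xV: "x \<in> V" using x C_iff by blast
  have "x \<in> face m x" "flip a x \<in> face m x"
    using in_face flip_in_face xV x(3) by auto
  moreover have "\<not> singular_face c G (face m x)"
    using y x calculation C_iff unfolding singular_face_iff[OF face_in_faces[OF xV]] by blast
  ultimately show ?thesis
    using x xV noL C_iff unfolding regular_face_def disperse_face_def continuous_face_def
    by (auto simp: C_iff)
qed

section \<open>Degrees of iso-points with respect to iso-lines\<close>

lemma iso_line_commute: "iso_line c G p q \<Longrightarrow> iso_line c G q p"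
  unfolding iso_line_def by (metis insert_commute)

lemma iso_lineE:
  assumes "iso_line c G p q"
  obtains i v where "v \<in> V" "regular_face c G (face i v)" "face_iso_points c G (face i v) = {p, q}"
  using assms unfolding iso_line_def regular_face_def faces_eq by blast

lemma iso_line_iso_points:
  assumes "iso_line c G p q"
  shows "p \<in> iso_points c G" "q \<in> iso_points c G"
  using assms face_iso_points_subset unfolding iso_line_def by blast+

lemma regular_face_iso_line:
  assumes "regular_face c G S" "p \<in> face_iso_points c G S"
  obtains q where "iso_line c G p q" "face_iso_points c G S = {p, q}"
proof -
  obtain a b where ab: "a \<noteq> b" "face_iso_points c G S = {a, b}"
    using regular_face_iso_points[OF assms(1)] by blast
  then have "p = a \<or> p = b" using assms(2) by auto
  then show thesis
  proof
    assume "p = a"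
    then show thesis using that[of b] ab assms(1) unfolding iso_line_def by blast
  next
    assume "p = b"
    then show thesis using that[of a] ab assms(1) unfolding iso_line_def
      by (metis insert_commute)
  qed
qed

text \<open>An iso-point that is not a node lies on exactly two faces. An iso-node lies on three, but on
  one of them it is not the end point of an iso-line, or that face is singular.\<close>

lemma iso_point_regular_faces:
  assumes "p \<in> iso_points c G"
  shows "\<exists>A B. \<forall>S. regular_face c G S \<and> p \<in> face_iso_points c G S \<longrightarrow> S = A \<or> S = B"
proof -
  obtain x a where x: "cut x a" "p = pt x a" using assms unfolding iso_points_iff by blast
  have xV: "x \<in> V" using x cut_vert by blast
  obtain j k where ajk: "a \<noteq> j" "a \<noteq> k" "j \<noteq> k" by (rule obtain_axes)
  \<comment> \<open>Every face in question passes through \<open>x\<close>; it is orthogonal to the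
    edge of \<open>p\<close> only if \<open>p\<close> is the node \<open>x\<close>.\<close>
  have S_face: "\<exists>m. S = face m x \<and> (m = a \<longrightarrow> label G x = c)"
    if S: "regular_face c G S" "p \<in> face_iso_points c G S" for S
  proof -
    obtain m v where m: "S = face m v" "v \<in> V" using S unfolding regular_face_def faces_eq by blast
    have pm: "p $ m = v $ m" using face_iso_points_nth S m by blast
    show ?thesis
    proof (cases "m = a")
      case True
      then have "label G x = c" "p = x" using pt_extremal[OF x(1) m(2)] pm x(2) by auto
      then show ?thesis using pm m face_cong by metis
    next
      case False
      then have "x $ m = v $ m" using pm x(2) pt_nth_other[of m a x] by simp
      then show ?thesis using m False face_cong by metis
    qed
  qed
  show ?thesis
  proof (cases "label G x = c")
    case False
    have "S = face j x \<or> S = face k x"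
      if S: "regular_face c G S" "p \<in> face_iso_points c G S" for S
    proof -
      obtain n where "S = face n x" "n \<noteq> a" using S_face[OF S] False by blast
      then show ?thesis using axis_cases[OF ajk, of n] by blast
    qed
    then show ?thesis by blast
  next
    case True
    then have px: "p = x" using x pt_corner by simp
    have ex: "\<exists>b. b \<noteq> m \<and> cut x b" if p: "p \<in> face_iso_points c G (face m x)" for m
    proof -
      obtain y b where y: "cut y b" "y \<in> face m x" "flip b y \<in> face m x" "p = pt y b"
        using p unfolding face_iso_points_iff by blast
      have "y = x" using y px xV pt_in_vertsD by metis
      then show ?thesis using y flip_in_face[OF xV] by blast
    qed
    \<comment> \<open>A face spanned by two cut edges at \<open>x\<close> is singular if its fourth
      node is disperse and an L-face otherwise.\<close>
    have no: "\<not> regular_face c G (face n x)"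
      if "cut x l" "cut x m" "l \<noteq> m" "l \<noteq> n" "m \<noteq> n" for l m n
    proof
      assume r: "regular_face c G (face n x)"
      let ?w = "flip l (flip m x)"
      have nodes: "face n x \<inter> V = {x, flip l x, flip m x, ?w}"
        using face_verts[OF xV, of n l m] that by blast
      have D: "flip l x \<in> D" "flip m x \<in> D" "x \<in> C" using that by (auto simp: cut_def)
      show False
      proof (cases "?w \<in> D")
        case w: True
        then have "singular_face c G (face n x)"
          using singular_face_iff[of "face n x"] nodes True xV D by auto
        then show False using r by (simp add: regular_face_def)
      next
        case w: False
        have "face n x = face n (flip l x)" using that by (simp add: face_def)
        moreover have "flip l (flip m (flip l x)) = flip m x" by (metis flip_commute flip_flip)
        ultimately have "face n x \<in> L_faces c G"
          unfolding L_face_iff using D w that xV C_iff flip_commute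
          by (intro exI[of _ "flip l x"] exI[of _ n] exI[of _ l] exI[of _ m]) auto
        then show False using r by (simp add: regular_face_def)
      qed
    qed
    have "\<exists>m. \<not> (regular_face c G (face m x) \<and> p \<in> face_iso_points c G (face m x))"
    proof (rule ccontr)
      assume "\<not> ?thesis"
      then have all: "regular_face c G (face m x)" "p \<in> face_iso_points c G (face m x)" for m by auto
      \<comment> \<open>The face orthogonal to \<open>a\<close> yields a second cut edge at
        \<open>x\<close>; the face spanned by both cut edges is then not regular.\<close>
      obtain b where b: "b \<noteq> a" "cut x b" using ex all(2) by blast
      obtain n where "a \<noteq> n" "b \<noteq> n" by (rule obtain_third_axis[OF b(1)[symmetric]])
      then show False using no[OF x(1) b(2)] b(1) all(1) by blast
    qed
    then obtain m where m: "\<not> (regular_face c G (face m x) \<and> p \<in> face_iso_points c G (face m x))" by blast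
    obtain j k where mjk: "m \<noteq> j" "m \<noteq> k" "j \<noteq> k" by (rule obtain_axes)
    have "S = face j x \<or> S = face k x"
      if S: "regular_face c G S" "p \<in> face_iso_points c G S" for S
    proof -
      obtain n where "S = face n x" using S_face[OF S] by blast
      then show ?thesis using m S axis_cases[OF mjk, of n] by blast
    qed
    then show ?thesis by blast
  qed
qed

text \<open>The face of an iso-line at \<open>p\<close> determines its other end point. At most two
  faces are available, so two of three lines share one.\<close>

lemma iso_line_degree_le_2:
  assumes "iso_line c G p q1" "iso_line c G p q2" "iso_line c G p q3"
  shows "q1 = q2 \<or> q1 = q3 \<or> q2 = q3"
proof -
  have ex: "\<exists>S. regular_face c G S \<and> p \<in> face_iso_points c G S \<and> face_iso_points c G S - {p} = {q}"
    if "iso_line c G p q" for q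
    using that unfolding iso_line_def by blast
  obtain S1 where S1: "regular_face c G S1" "p \<in> face_iso_points c G S1" "face_iso_points c G S1 - {p} = {q1}"
    using ex[OF assms(1)] by blast
  obtain S2 where S2: "regular_face c G S2" "p \<in> face_iso_points c G S2" "face_iso_points c G S2 - {p} = {q2}"
    using ex[OF assms(2)] by blast
  obtain S3 where S3: "regular_face c G S3" "p \<in> face_iso_points c G S3" "face_iso_points c G S3 - {p} = {q3}"
    using ex[OF assms(3)] by blast
  obtain A B where AB: "\<And>S. regular_face c G S \<Longrightarrow> p \<in> face_iso_points c G S \<Longrightarrow> S = A \<or> S = B"
    using iso_point_regular_faces iso_line_iso_points(1)[OF assms(1)] by metis
  have "S1 = S2 \<or> S1 = S3 \<or> S2 = S3" using AB[of S1] AB[of S2] AB[of S3] S1 S2 S3 by auto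
  then show ?thesis using S1 S2 S3 by auto
qed

text \<open>Two regular faces supply the lines. If \<open>p\<close> is not a node, they are the two
  faces at its edge. At an iso-node the absence of T1-subgraphs gives a continuous neighbour, and
  faces containing a second continuous node are not singular.\<close>

lemma iso_line_degree_ge_2:
  assumes noL: "L_faces c G = {}" and noT1: "\<nexists>H. T1_subgraph c G H"
    and noT2: "\<nexists>H. T2_subgraph c G H" and p: "p \<in> iso_points c G"
  shows "\<exists>q1 q2. q1 \<noteq> q2 \<and> iso_line c G p q1 \<and> iso_line c G p q2"
proof -
  obtain x a where x: "cut x a" "p = pt x a" using p unfolding iso_points_iff by blast
  have xV: "x \<in> V" and xC: "x \<in> C" using x cut_vert by (auto simp: cut_def)
  text \<open>The two iso-lines have different second end points unless both of these lie on the
    edge shared by the two faces.\<close>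
  have faces: ?thesis
    if reg: "regular_face c G (face m x)" "regular_face c G (face n x)" "m \<noteq> n" "a \<noteq> m" "b \<noteq> n"
      and b: "cut x b" "p = pt x b"
      and no: "\<And>q. q \<in> V \<Longrightarrow> p \<in> V \<Longrightarrow> q \<in> face m x \<Longrightarrow> q \<in> face n x \<Longrightarrow> q \<noteq> p \<Longrightarrow>
        face_iso_points c G (face m x) = {p, q} \<Longrightarrow> face_iso_points c G (face n x) = {p, q} \<Longrightarrow> False"
    for m n b
  proof -
    have pm: "p \<in> face_iso_points c G (face m x)"
      unfolding face_iso_points_iff using x in_face[OF xV] flip_in_face[OF xV] reg by blast
    have pn: "p \<in> face_iso_points c G (face n x)"
      unfolding face_iso_points_iff using b in_face[OF xV] flip_in_face[OF xV] reg by blast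
    obtain q1 where q1: "iso_line c G p q1" "face_iso_points c G (face m x) = {p, q1}"
      using regular_face_iso_line[OF reg(1) pm] by blast
    obtain q2 where q2: "iso_line c G p q2" "face_iso_points c G (face n x) = {p, q2}"
      using regular_face_iso_line[OF reg(2) pn] by blast
    have "q1 \<noteq> q2"
    proof
      assume eq: "q1 = q2"
      have n: "p $ m = x $ m" "q1 $ m = x $ m" "p $ n = x $ n" "q1 $ n = x $ n"
        using face_iso_points_nth q1 q2 eq by blast+
      have qp: "q1 \<noteq> p" using q1(1) by (auto simp: iso_line_def)
      have "p \<in> V \<and> q1 \<in> V"
        using iso_points_on_edge[OF p iso_line_iso_points(2)[OF q1(1)] _ reg(3) xV] n qp by blast
      then show False using no[of q1] q1 q2 eq qp n in_face_iff by auto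
    qed
    then show ?thesis using q1 q2 by blast
  qed
  show ?thesis
  proof (cases "label G x = c")
    case False
    obtain j k where ajk: "a \<noteq> j" "a \<noteq> k" "j \<noteq> k" by (rule obtain_axes)
    have "p \<notin> V" using False x pt_in_vertsD by blast
    moreover have "regular_face c G (face j x)" "regular_face c G (face k x)"
      using regular_faceI[OF noL xC, of a] x(1) False ajk by (auto simp: cut_def)
    ultimately show ?thesis using faces[of j k a] ajk x by blast
  next
    case True
    then have px: "p = pt x b" "p = x" if "cut x b" for b using that x pt_corner by auto
    obtain m where m: "flip m x \<in> C" using T1_free[OF noT1 xV True] by blast
    have am: "a \<noteq> m" using m x(1) C_iff by (auto simp: cut_def)
    \<comment> \<open>The node along the third axis \<open>b\<close> decides which face accompanies
      \<open>face b x\<close>: \<open>face a x\<close> if that node is disperse,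
      \<open>face m x\<close> if it is continuous.\<close>
    obtain b where b: "a \<noteq> b" "m \<noteq> b" by (rule obtain_third_axis[OF am])
    have aD: "flip a x \<in> D" using x by (simp add: cut_def)
    have mf: "flip m x \<in> face b x" "flip m x \<in> face a x" "flip m x \<noteq> x"
      using flip_in_face xV b am by auto
    have rb: "regular_face c G (face b x)" using regular_faceI[OF noL xC aD b(1)] mf m by blast
    have ridge: "y = x \<or> y = flip n x" if "y \<in> V" "y \<in> face i x" "y \<in> face j x" "i \<noteq> j" "i \<noteq> n" "j \<noteq> n"
      for y i j n
      using verts_ridge[OF xV that(1) _ _ that(4-6)] that by (auto simp: face_def)
    show ?thesis
    proof (cases "cut x b")
      case bc: True
      have bD: "flip b x \<in> D" using bc by (simp add: cut_def)
      have ra: "regular_face c G (face a x)"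
        using regular_faceI[OF noL xC bD, of a] b mf m by blast
      show ?thesis
      proof (rule faces[OF rb ra _ b(1) _ bc px(1)[OF bc]])
        fix q assume q: "q \<in> V" "p \<in> V" "q \<in> face b x" "q \<in> face a x" "q \<noteq> p"
           "face_iso_points c G (face b x) = {p, q}" "face_iso_points c G (face a x) = {p, q}"
        have pxx: "p = x" using px x by blast
        \<comment> \<open>The two faces share the edge at \<open>x\<close> along
          \<open>m\<close>.\<close>
        have qm: "q = flip m x" using ridge[OF q(1,3,4), of m] b am q(5) pxx by auto
        have qc: "label G q = c"
          using q(1,6) iso_point_vert(1)[of q] face_iso_points_subset by blast
        \<comment> \<open>The node \<open>q\<close> is an iso-point through a cut edge at
          \<open>q\<close> in the face. This edge does not run along \<open>m\<close>, where the
          neighbour \<open>x\<close> is continuous, so it runs along the other axis of the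
          face.\<close>
        have corner: "flip l q \<in> D" if lm: "l \<noteq> m" "l \<noteq> n" "n \<noteq> m"
          and f: "face_iso_points c G (face n x) = {p, q}" for l n
        proof -
          obtain y e where y: "cut y e" "y \<in> face n x" "flip e y \<in> face n x" "q = pt y e"
            using face_iso_points_iff[of q "face n x"] f by blast
          have yq: "y = q" using y q(1) pt_in_vertsD by metis
          have "flip m q \<notin> D" using qm xC C_iff by simp
          then have "e \<noteq> m" using y(1) yq by (auto simp: cut_def)
          moreover have "face n x = face n q" using y(2) yq by (simp add: face_def)
          then have "e \<noteq> n" using y(3) yq flip_in_face[OF q(1)] by blast
          ultimately have "e = l" using axis_cases[of l m n e] lm by auto
          then show ?thesis using y(1) yq by (simp add: cut_def)
        qed
        have aq: "flip a (flip m x) \<in> D" using corner[of a b] q(6) am b qm by auto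
        have bq: "flip b (flip m x) \<in> D" using corner[of b a] q(7) am b qm by auto
        have abD: "flip a (flip b x) \<in> D"
        proof -
          have "flip a (flip b (flip b x)) \<in> D" using aD by simp
          then have "flip a (flip b x) \<in> D \<or> flip b (flip b x) \<in> D"
            using no_L_face[OF noL b(1) bD] by blast
          then show ?thesis using xC C_iff by auto
        qed
        \<comment> \<open>\<open>?z\<close> is antipodal to \<open>x\<close> and the only node of
          undetermined kind. Leaving it out gives a T2-subgraph in either case.\<close>
        let ?z = "flip a (flip m (flip b x))"
        have Veq: "V = {x, flip a x, flip m x, flip b x, flip a (flip m x), flip a (flip b x),
              flip m (flip b x), ?z}"
          by (rule verts_eq[OF xV am b(1) b(2)])
        have "flip m (flip b x) \<in> D" using bq by (simp add: flip_commute)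
        then have "V - {x, flip m x, ?z} \<subseteq> D"
          using aD bD aq abD unfolding Veq by blast
        moreover have "?z \<in> V" "?z \<noteq> x" "?z \<noteq> flip m x" using xV am b by (simp_all add: flip_commute[of a m])
        ultimately show False using T2_free[OF noT2 xV True, of m ?z] qc qm by blast
      qed (use b in auto)
    next
      case False
      then have bC: "flip b x \<in> C" using xC xV C_iff by (auto simp: cut_def)
      have "flip b x \<in> face m x" "flip b x \<noteq> x" using flip_in_face xV b by auto
      then have rm: "regular_face c G (face m x)" using regular_faceI[OF noL xC aD am] bC by blast
      show ?thesis
      proof (rule faces[OF rb rm _ b(1) am x])
        fix q assume q: "q \<in> V" "p \<in> V" "q \<in> face b x" "q \<in> face m x" "q \<noteq> p"
          "face_iso_points c G (face b x) = {p, q}"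
        \<comment> \<open>Here the shared edge runs along \<open>a\<close>; its other end is
          disperse and hence not an iso-point.\<close>
        have "q = flip a x" using ridge[OF q(1,3,4), of a] b am q(5) px x by auto
        moreover have "q \<in> C"
          using q(1,6) iso_point_vert(2)[of q] face_iso_points_subset by blast
        ultimately show False using aD C_iff by blast
      qed (use b in auto)
    qed
  qed
qed

section \<open>Intersections of iso-lines\<close>

text \<open>A coordinate of a node is extreme on the cuboid, and a proper convex combination attains
  an extreme value only if both end points do.\<close>

lemma closed_segment_extremal:
  assumes "p \<in> cuboid G" "q \<in> cuboid G" "v \<in> V" "z \<in> closed_segment p q" "z \<noteq> p" "z \<noteq> q"
    and "z $ m = v $ m"
  shows "p $ m = v $ m \<and> q $ m = v $ m"
proof -
  obtain u where u: "0 \<le> u" "u \<le> 1" "z = (1 - u) *\<^sub>R p + u *\<^sub>R q"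
    using assms(4) by (auto simp: closed_segment_def)
  have u0: "0 < u" "u < 1" using u assms(5,6) by (auto simp: less_le)
  have z: "(1 - u) * (p $ m - v $ m) + u * (q $ m - v $ m) = 0"
    using assms(7) u(3) by (simp add: algebra_simps)
  have b: "lo G $ m \<le> p $ m" "p $ m \<le> hi G $ m" "lo G $ m \<le> q $ m" "q $ m \<le> hi G $ m"
    using assms(1,2) by (auto simp: cuboid_nth)
  have "v $ m = lo G $ m \<or> v $ m = hi G $ m" using assms(3) by (simp add: verts_def)
  then show ?thesis
  proof
    assume v: "v $ m = lo G $ m"
    have "0 \<le> (1 - u) * (p $ m - v $ m)" "0 \<le> u * (q $ m - v $ m)" using u0 b v by auto
    then have "(1 - u) * (p $ m - v $ m) = 0" "u * (q $ m - v $ m) = 0" using z by linarith+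
    then show ?thesis using u0 by simp
  next
    assume v: "v $ m = hi G $ m"
    have "(1 - u) * (p $ m - v $ m) \<le> 0" "u * (q $ m - v $ m) \<le> 0"
      using u0 b v by (auto intro!: mult_nonneg_nonpos)
    then have "(1 - u) * (p $ m - v $ m) = 0" "u * (q $ m - v $ m) = 0" using z by linarith+
    then show ?thesis using u0 by simp
  qed
qed

lemma closed_segment_nth:
  fixes p :: "real^3"
  assumes "z \<in> closed_segment p q" "p $ m = s" "q $ m = s"
  shows "z $ m = s"
proof -
  obtain u where "z = (1 - u) *\<^sub>R p + u *\<^sub>R q"
    using assms(1) by (auto simp: closed_segment_def)
  then have "z $ m = (1 - u) * s + u * s" using assms(2,3) by simp
  then show ?thesis by argo
qed

text \<open>A meeting point inside the first line lies on both faces, and by extremality so does the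
  first line. Hence \<open>p\<close> and \<open>q\<close> are the two nodes of the common edge. The
  second line would then have a third iso-point of that edge as an end point or coincide with the
  first line.\<close>

lemma iso_lines_meet_at_end_point:
  assumes pq: "iso_line c G p q" and pq': "iso_line c G p' q'" and ne: "{p, q} \<noteq> {p', q'}"
    and z: "z \<in> closed_segment p q" "z \<in> closed_segment p' q'"
  shows "z \<in> {p, q}"
proof (rule ccontr)
  assume no: "z \<notin> {p, q}"
  obtain i v where v: "v \<in> V" "face_iso_points c G (face i v) = {p, q}" by (rule iso_lineE[OF pq])
  obtain i' v' where v': "v' \<in> V" "face_iso_points c G (face i' v') = {p', q'}" by (rule iso_lineE[OF pq'])
  note iso = iso_line_iso_points[OF pq] iso_line_iso_points[OF pq']
  have n: "p $ i = v $ i" "q $ i = v $ i" "p' $ i' = v' $ i'" "q' $ i' = v' $ i'"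
    using v v' face_iso_points_nth by blast+
  have zn: "z $ i = v $ i" "z $ i' = v' $ i'"
    using closed_segment_nth z n by blast+
  have ii: "i \<noteq> i'"
  proof
    assume "i = i'"
    then have "face i v = face i' v'" using zn by (intro face_cong[of v i v', THEN trans]) auto
    then show False using v v' ne by simp
  qed
  have n': "p $ i' = v' $ i'" "q $ i' = v' $ i'"
    using closed_segment_extremal[of p q v' z i'] iso iso_point_in_cuboid v' z no zn by auto
  have pne: "p \<noteq> q" "p' \<noteq> q'" using pq pq' by (auto simp: iso_line_def)
  \<comment> \<open>\<open>w\<close> is a node on the edge shared by the two faces.\<close>
  obtain w where w: "w \<in> V" "w $ i = v $ i" "w $ i' = v' $ i'"
  proof
    let ?w = "\<chi> m. if m = i then v $ m else v' $ m"
    show "?w \<in> V" using v(1) v'(1) by (auto simp: verts_def)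
    show "?w $ i = v $ i" "?w $ i' = v' $ i'" using ii by auto
  qed
  have pV: "p \<in> V \<and> q \<in> V"
    using iso_points_on_edge[OF iso(1,2) pne(1) ii w(1)] n n' w by simp
  obtain k where k: "i \<noteq> k" "i' \<noteq> k" by (rule obtain_third_axis[OF ii])
  have only: "r \<in> {p, q}" if r: "r \<in> V" "r $ i = v $ i" "r $ i' = v' $ i'" for r
  proof -
    have "r = p \<or> r = flip k p" "q = p \<or> q = flip k p"
      using verts_ridge[of p _ i i' k] r pV n n' ii k by simp_all
    then show ?thesis using pne by auto
  qed
  show False
  proof (cases "z \<in> {p', q'}")
    case True
    then have "z \<in> iso_points c G" using iso by auto
    then have "z \<in> V" using iso_points_on_edge[OF iso(1) _ _ ii w(1)] n n' w zn no by auto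
    then show False using only zn no by blast
  next
    case False
    then have "p' $ i = v $ i \<and> q' $ i = v $ i"
      using closed_segment_extremal[of p' q' v z i] iso iso_point_in_cuboid v z zn by auto
    then have "p' \<in> {p, q}" "q' \<in> {p, q}"
      using only iso_points_on_edge[OF iso(3,4) pne(2) ii w(1)] n w by auto
    then show False using ne pne by auto
  qed
qed

lemma iso_lines_disjoint:
  assumes "iso_line c G p q" "iso_line c G p' q'" "{p, q} \<noteq> {p', q'}"
  shows "closed_segment p q \<inter> closed_segment p' q' \<subseteq> {p, q} \<inter> {p', q'}"
  using iso_lines_meet_at_end_point[OF assms]
    iso_lines_meet_at_end_point[OF assms(2,1) assms(3)[symmetric]] by blast

end

section \<open>Connectedness of the iso-points\<close>

text \<open>
  \<open>vo\<close>, \<open>vi\<close>, \<dots>, \<open>vijk\<close> say which nodes of a cube are disperse, \<open>e_x_y\<close> says that the iso-point on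
  the edge joining \<open>vx\<close> and \<open>vy\<close> (with \<open>0\<close> for \<open>o\<close>) belongs to a set that contains with one iso-point
  of a face all of them. There are no L-faces, and no two antipodal nodes differ from all others.
\<close>

lemma cube_boundary_connected:
  fixes vo vi vj vij vk vik vjk vijk
    e_0_i e_j_ij e_k_ik e_jk_ijk e_0_j e_i_ij e_k_jk e_ik_ijk e_0_k e_i_ik e_j_jk e_ij_ijk :: bool
  assumes
    "\<not> (vo \<and> \<not> vj \<and> vjk \<and> \<not> vk)"
    "\<not> (vj \<and> \<not> vo \<and> vk \<and> \<not> vjk)"
    "\<not> (vi \<and> \<not> vij \<and> vijk \<and> \<not> vik)"
    "\<not> (vij \<and> \<not> vi \<and> vik \<and> \<not> vijk)"
    "\<not> (vo \<and> \<not> vi \<and> vik \<and> \<not> vk)"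
    "\<not> (vi \<and> \<not> vo \<and> vk \<and> \<not> vik)"
    "\<not> (vj \<and> \<not> vij \<and> vijk \<and> \<not> vjk)"
    "\<not> (vij \<and> \<not> vj \<and> vjk \<and> \<not> vijk)"
    "\<not> (vo \<and> \<not> vi \<and> vij \<and> \<not> vj)"
    "\<not> (vi \<and> \<not> vo \<and> vj \<and> \<not> vij)"
    "\<not> (vk \<and> \<not> vik \<and> vijk \<and> \<not> vjk)"
    "\<not> (vik \<and> \<not> vk \<and> vjk \<and> \<not> vijk)"
    "\<not> (vo \<and> vijk \<and> \<not> vi \<and> \<not> vj \<and> \<not> vk \<and> \<not> vij \<and> \<not> vik \<and> \<not> vjk)"
    "\<not> (\<not> vo \<and> \<not> vijk \<and> vi \<and> vj \<and> vk \<and> vij \<and> vik \<and> vjk)"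
    "\<not> (vi \<and> vjk \<and> \<not> vo \<and> \<not> vij \<and> \<not> vik \<and> \<not> vj \<and> \<not> vk \<and> \<not> vijk)"
    "\<not> (\<not> vi \<and> \<not> vjk \<and> vo \<and> vij \<and> vik \<and> vj \<and> vk \<and> vijk)"
    "\<not> (vj \<and> vik \<and> \<not> vij \<and> \<not> vo \<and> \<not> vjk \<and> \<not> vi \<and> \<not> vijk \<and> \<not> vk)"
    "\<not> (\<not> vj \<and> \<not> vik \<and> vij \<and> vo \<and> vjk \<and> vi \<and> vijk \<and> vk)"
    "\<not> (vk \<and> vij \<and> \<not> vik \<and> \<not> vjk \<and> \<not> vo \<and> \<not> vijk \<and> \<not> vi \<and> \<not> vj)"
    "\<not> (\<not> vk \<and> \<not> vij \<and> vik \<and> vjk \<and> vo \<and> vijk \<and> vi \<and> vj)"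
    "e_0_j \<or> e_j_jk \<or> e_k_jk \<or> e_0_k \<longrightarrow>
      (vo \<noteq> vj \<longrightarrow> e_0_j) \<and> (vj \<noteq> vjk \<longrightarrow> e_j_jk) \<and> (vjk \<noteq> vk \<longrightarrow> e_k_jk) \<and> (vk \<noteq> vo \<longrightarrow> e_0_k)"
    "e_i_ij \<or> e_ij_ijk \<or> e_ik_ijk \<or> e_i_ik \<longrightarrow>
      (vi \<noteq> vij \<longrightarrow> e_i_ij) \<and> (vij \<noteq> vijk \<longrightarrow> e_ij_ijk) \<and> (vijk \<noteq> vik \<longrightarrow> e_ik_ijk) \<and> (vik \<noteq> vi \<longrightarrow> e_i_ik)"
    "e_0_i \<or> e_i_ik \<or> e_k_ik \<or> e_0_k \<longrightarrow>
      (vo \<noteq> vi \<longrightarrow> e_0_i) \<and> (vi \<noteq> vik \<longrightarrow> e_i_ik) \<and> (vik \<noteq> vk \<longrightarrow> e_k_ik) \<and> (vk \<noteq> vo \<longrightarrow> e_0_k)"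
    "e_j_ij \<or> e_ij_ijk \<or> e_jk_ijk \<or> e_j_jk \<longrightarrow>
      (vj \<noteq> vij \<longrightarrow> e_j_ij) \<and> (vij \<noteq> vijk \<longrightarrow> e_ij_ijk) \<and> (vijk \<noteq> vjk \<longrightarrow> e_jk_ijk) \<and> (vjk \<noteq> vj \<longrightarrow> e_j_jk)"
    "e_0_i \<or> e_i_ij \<or> e_j_ij \<or> e_0_j \<longrightarrow>
      (vo \<noteq> vi \<longrightarrow> e_0_i) \<and> (vi \<noteq> vij \<longrightarrow> e_i_ij) \<and> (vij \<noteq> vj \<longrightarrow> e_j_ij) \<and> (vj \<noteq> vo \<longrightarrow> e_0_j)"
    "e_k_ik \<or> e_ik_ijk \<or> e_jk_ijk \<or> e_k_jk \<longrightarrow>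
      (vk \<noteq> vik \<longrightarrow> e_k_ik) \<and> (vik \<noteq> vijk \<longrightarrow> e_ik_ijk) \<and> (vijk \<noteq> vjk \<longrightarrow> e_jk_ijk) \<and> (vjk \<noteq> vk \<longrightarrow> e_k_jk)"
    "\<not> vo" "vi" "e_0_i"
  shows "(vo \<noteq> vi \<longrightarrow> e_0_i) \<and>
    (vj \<noteq> vij \<longrightarrow> e_j_ij) \<and>
    (vk \<noteq> vik \<longrightarrow> e_k_ik) \<and>
    (vjk \<noteq> vijk \<longrightarrow> e_jk_ijk) \<and>
    (vo \<noteq> vj \<longrightarrow> e_0_j) \<and>
    (vi \<noteq> vij \<longrightarrow> e_i_ij) \<and>
    (vk \<noteq> vjk \<longrightarrow> e_k_jk) \<and>
    (vik \<noteq> vijk \<longrightarrow> e_ik_ijk) \<and>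
    (vo \<noteq> vk \<longrightarrow> e_0_k) \<and>
    (vi \<noteq> vik \<longrightarrow> e_i_ik) \<and>
    (vj \<noteq> vjk \<longrightarrow> e_j_jk) \<and>
    (vij \<noteq> vijk \<longrightarrow> e_ij_ijk)"
  using assms(1-20) assms(21-26)[THEN mp] assms(27-29)
  \<comment> \<open>Six nodes are undecided. In each colouring either a forbidden pattern occurs or
    \<open>e_0_i\<close> is passed on from face to face to all cut edges.\<close>
  by (cases vj; cases vk; cases vij; cases vik; cases vjk; cases vijk) simp_all

context cuboid_level
begin

section \<open>Basic subgraphs and excluded antipodal colourings\<close>

lemma star_in_g1:
  assumes "P \<in> D" "\<And>m. flip m P \<in> C"
  shows "star P \<in> g1_subgraphs c G"
proof -
  have "{Q. incident G P Q} \<subseteq> C" using assms by (auto simp: incident_iff)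
  then show ?thesis
    using assms(1) subgraph_star D_verts unfolding g1_subgraphs_def by auto
qed

lemma star_in_g3:
  assumes "P \<in> V" "label G P < c" "\<And>m. flip m P \<in> D"
  shows "star P \<in> g3_subgraphs c G"
proof -
  have "{Q. incident G P Q} \<subseteq> D" using assms by (auto simp: incident_iff)
  then show ?thesis
    using assms(1,2) subgraph_star unfolding g3_subgraphs_def by auto
qed

lemma eq_starI:
  assumes "subgraph A G" "sverts A = insert P {Q. incident G P Q}"
    "sedges A = {{P, Q} | Q. incident G P Q}"
  shows "A = star P"
  using assms by (simp add: star_def subgraph_def)

lemma g1E:
  assumes "A \<in> g1_subgraphs c G"
  obtains P where "P \<in> D" "\<And>m. flip m P \<in> C" "A = star P"
proof -
  obtain P where P: "P \<in> D" "{Q. incident G P Q} \<subseteq> C" "A = star P"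
    using assms eq_starI unfolding g1_subgraphs_def by blast
  then have "flip m P \<in> C" for m using D_verts incident_flip(1) by blast
  then show thesis using that P by blast
qed

lemma g3E:
  assumes "A \<in> g3_subgraphs c G"
  obtains P where "P \<in> V" "label G P < c" "\<And>m. flip m P \<in> D" "A = star P"
proof -
  obtain P where P: "P \<in> V" "label G P < c" "{Q. incident G P Q} \<subseteq> D" "A = star P"
    using assms eq_starI unfolding g3_subgraphs_def by blast
  then have "flip m P \<in> D" for m using incident_flip(1) by blast
  then show thesis using that P by blast
qed

text \<open>\<open>g3_subgraphs\<close> demands a label strictly below \<open>c\<close>; label
  \<open>c\<close> would make the star of \<open>P\<close> a T1-subgraph.\<close>

lemma label_less_if_T1_free:
  assumes "\<nexists>H. T1_subgraph c G H" "P \<in> C" "\<And>m. flip m P \<in> D"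
  shows "label G P < c"
proof -
  have "label G P \<noteq> c" using T1_free[OF assms(1), of P] assms(2,3) C_iff by metis
  then show ?thesis using assms(2) by (auto simp: continuous_nodes_def)
qed

text \<open>This colouring has exactly two disperse nodes, and the star of \<open>P\<close> belongs
  to \<open>g1_subgraphs\<close>.\<close>

lemma no_antipodal_disperse:
  assumes "\<not> (card D = 2 \<and> g1_subgraphs c G \<noteq> {})" "i \<noteq> j" "i \<noteq> k" "j \<noteq> k" "P \<in> V"
  shows "\<not> (P \<in> D \<and> flip i (flip j (flip k P)) \<in> D \<and> flip i P \<notin> D \<and> flip j P \<notin> D \<and> flip k P \<notin> D \<and>
    flip i (flip j P) \<notin> D \<and> flip i (flip k P) \<notin> D \<and> flip j (flip k P) \<notin> D)"
proof
  assume *: "P \<in> D \<and> flip i (flip j (flip k P)) \<in> D \<and> flip i P \<notin> D \<and> flip j P \<notin> D \<and> flip k P \<notin> D \<and>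
    flip i (flip j P) \<notin> D \<and> flip i (flip k P) \<notin> D \<and> flip j (flip k P) \<notin> D"
  have "D \<subseteq> {P, flip i (flip j (flip k P))}"
  proof
    fix Q assume Q: "Q \<in> D"
    then have "Q \<in> V" by (rule D_verts)
    then show "Q \<in> {P, flip i (flip j (flip k P))}"
      using * Q unfolding verts_eq[OF assms(5,2-4)] by blast
  qed
  then have "D = {P, flip i (flip j (flip k P))}" using * by blast
  then have "card D = 2" using assms(2-5) by simp
  moreover have "flip m P \<in> C" for m
    using * axis_cases[OF assms(2-4), of m] assms(5) by (auto simp: C_iff)
  then have "star P \<in> g1_subgraphs c G" using * star_in_g1 by blast
  ultimately show False using assms(1) by blast
qed

text \<open>The same with the colours exchanged; the absence of T1-subgraphs supplies the strict
  inequality for the label of \<open>P\<close>.\<close>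

lemma no_antipodal_continuous:
  assumes "\<not> (card D = 6 \<and> g3_subgraphs c G \<noteq> {})" "\<nexists>H. T1_subgraph c G H"
    "i \<noteq> j" "i \<noteq> k" "j \<noteq> k" "P \<in> V"
  shows "\<not> (P \<notin> D \<and> flip i (flip j (flip k P)) \<notin> D \<and> flip i P \<in> D \<and> flip j P \<in> D \<and> flip k P \<in> D \<and>
    flip i (flip j P) \<in> D \<and> flip i (flip k P) \<in> D \<and> flip j (flip k P) \<in> D)"
proof
  assume *: "P \<notin> D \<and> flip i (flip j (flip k P)) \<notin> D \<and> flip i P \<in> D \<and> flip j P \<in> D \<and> flip k P \<in> D \<and>
    flip i (flip j P) \<in> D \<and> flip i (flip k P) \<in> D \<and> flip j (flip k P) \<in> D"
  have "V - {P, flip i (flip j (flip k P))} \<subseteq> D"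
    using * unfolding verts_eq[OF assms(6,3-5)] by blast
  then have "D = V - {P, flip i (flip j (flip k P))}" using * D_verts by blast
  then have "card D = 6" using assms(3-6) card_verts by (simp add: card_Diff_subset)
  moreover have D: "flip m P \<in> D" for m
    using * axis_cases[OF assms(3-5), of m] by auto
  then have "star P \<in> g3_subgraphs c G"
    using star_in_g3[OF assms(6) _ D] label_less_if_T1_free[OF assms(2) _ D] * assms(6) C_iff by blast
  ultimately show False using assms(1) by blast
qed

text \<open>The two iso-points of a regular face are joined by an iso-line. Without L-faces, any
  other face with a cut edge is singular, and its cut edges all yield the same iso-node.\<close>

lemma face_iso_points_closed:
  assumes noL: "L_faces c G = {}" and S: "S \<in> faces G"
    and X: "\<And>p q. p \<in> X \<Longrightarrow> iso_line c G p q \<Longrightarrow> q \<in> X"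
    and p: "p \<in> face_iso_points c G S" "p \<in> X" and q: "q \<in> face_iso_points c G S"
  shows "q \<in> X"
proof (cases "regular_face c G S")
  case True
  obtain q' where q': "iso_line c G p q'" "face_iso_points c G S = {p, q'}"
    by (rule regular_face_iso_line[OF True p(1)])
  then have "q = p \<or> q = q'" using q by simp
  then show ?thesis using X[OF p(2) q'(1)] p(2) by auto
next
  case False
  obtain x i where x: "cut x i" "x \<in> S" "flip i x \<in> S" "p = pt x i"
    using p(1) unfolding face_iso_points_iff by blast
  obtain y j where y: "cut y j" "y \<in> S" "flip j y \<in> S" "q = pt y j"
    using q unfolding face_iso_points_iff by blast
  have "singular_face c G S"
    using False noL S x C_iff D_verts
    unfolding regular_face_def disperse_face_def continuous_face_def cut_def by blast
  then obtain z where z: "label G z = c" "S \<inter> V - {z} \<subseteq> D" unfolding singular_face_iff[OF S] by blast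
  have "x = z" "y = z" using x y z C_iff unfolding cut_def by blast+
  then have "p = z" "q = z" using x y z pt_corner by auto
  then show ?thesis using p by simp
qed

text \<open>Closure of \<open>X\<close> under iso-lines passes from one cut edge of a face to all of
  them. In a frame at the cut edge of \<open>p\<close> this reduces the claim to
  \<open>cube_boundary_connected\<close>.\<close>

lemma iso_points_connected:
  assumes noL: "L_faces c G = {}" and noT1: "\<nexists>H. T1_subgraph c G H"
    and two: "\<not> (card D = 2 \<and> g1_subgraphs c G \<noteq> {})"
    and six: "\<not> (card D = 6 \<and> g3_subgraphs c G \<noteq> {})"
    and X: "\<And>p q. p \<in> X \<Longrightarrow> iso_line c G p q \<Longrightarrow> q \<in> X"
    and p: "p \<in> X" "p \<in> iso_points c G" and q: "q \<in> iso_points c G"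
  shows "q \<in> X"
proof -
  \<comment> \<open>\<open>e u m\<close> does not depend on which end of the edge is called
    \<open>u\<close>, and it is false on edges with ends of the same kind.\<close>
  define e where "e u m \<longleftrightarrow> cut u m \<and> pt u m \<in> X \<or> cut (flip m u) m \<and> pt (flip m u) m \<in> X" for u m
  have e_flip: "e (flip m u) m = e u m" for u m by (auto simp: e_def)
  have e_mono: "e w b"
    if S: "S \<in> faces G" and e: "e u a" and u: "u \<in> S" "flip a u \<in> S" and w: "w \<in> S" "flip b w \<in> S"
      and cw: "(w \<in> D) \<noteq> (flip b w \<in> D)" and wV: "w \<in> V" for S u a w b
  proof -
    obtain p where p: "p \<in> face_iso_points c G S" "p \<in> X"
    proof (cases "cut u a \<and> pt u a \<in> X")
      case True
      then show thesis using u that unfolding face_iso_points_iff by blast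
    next
      case False
      then have "cut (flip a u) a" "pt (flip a u) a \<in> X" using e by (auto simp: e_def)
      moreover have "flip a (flip a u) \<in> S" using u by simp
      ultimately show thesis using u that unfolding face_iso_points_iff by blast
    qed
    have closed: "q \<in> X" if "q \<in> face_iso_points c G S" for q
      by (rule face_iso_points_closed[OF noL S _ p that]) (rule X)
    show ?thesis
    proof (cases "w \<in> D")
      case True
      then have c: "cut (flip b w) b" using cw wV by (simp add: cut_def C_iff)
      moreover have "flip b (flip b w) \<in> S" using w by simp
      ultimately have "pt (flip b w) b \<in> face_iso_points c G S"
        using w unfolding face_iso_points_iff by blast
      then have "pt (flip b w) b \<in> X" by (rule closed)
      then show ?thesis using c by (simp add: e_def)
    next
      case False
      then have c: "cut w b" using cw wV by (simp add: cut_def C_iff)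
      then have "pt w b \<in> face_iso_points c G S"
        using w unfolding face_iso_points_iff by blast
      then have "pt w b \<in> X" by (rule closed)
      then show ?thesis using c by (simp add: e_def)
    qed
  qed
  have face_rule: "e u a \<or> e (flip a u) b \<or> e (flip b u) a \<or> e u b \<longrightarrow>
      ((u \<in> D) \<noteq> (flip a u \<in> D) \<longrightarrow> e u a) \<and>
      ((flip a u \<in> D) \<noteq> (flip a (flip b u) \<in> D) \<longrightarrow> e (flip a u) b) \<and>
      ((flip a (flip b u) \<in> D) \<noteq> (flip b u \<in> D) \<longrightarrow> e (flip b u) a) \<and>
      ((flip b u \<in> D) \<noteq> (u \<in> D) \<longrightarrow> e u b)"
    if d: "n \<noteq> a" "n \<noteq> b" and u: "u \<in> V" for n a b u
  proof
    assume e: "e u a \<or> e (flip a u) b \<or> e (flip b u) a \<or> e u b"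
    have S: "face n u \<in> faces G" using u by simp
    have m: "u \<in> face n u" "flip a u \<in> face n u" "flip b u \<in> face n u"
      "flip b (flip a u) \<in> face n u" "flip a (flip b u) \<in> face n u"
      using u d by (auto simp: in_face_iff)
    obtain w l where w: "e w l" "w \<in> face n u" "flip l w \<in> face n u" using e m by blast
    note mono = e_mono[OF S w]
    show "((u \<in> D) \<noteq> (flip a u \<in> D) \<longrightarrow> e u a) \<and>
      ((flip a u \<in> D) \<noteq> (flip a (flip b u) \<in> D) \<longrightarrow> e (flip a u) b) \<and>
      ((flip a (flip b u) \<in> D) \<noteq> (flip b u \<in> D) \<longrightarrow> e (flip b u) a) \<and>
      ((flip b u \<in> D) \<noteq> (u \<in> D) \<longrightarrow> e u b)"
      using mono[of u a] mono[of "flip a u" b] mono[of "flip b u" a] mono[of u b] m u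
      by (simp add: flip_commute[of b a])
  qed
  obtain v i where v: "cut v i" "p = pt v i" using p(2) unfolding iso_points_iff by blast
  have vV: "v \<in> V" using v cut_vert by blast
  obtain j k where ijk: "i \<noteq> j" "i \<noteq> k" "j \<noteq> k" by (rule obtain_axes)
  \<comment> \<open>A normal form with \<open>flip i\<close> outermost and \<open>flip k\<close>
    innermost, in which the instances below speak of the eight nodes of the frame.\<close>
  have comm: "flip j (flip i P) = flip i (flip j P)" "flip k (flip i P) = flip i (flip k P)"
    "flip k (flip j P) = flip j (flip k P)" for P by (simp_all add: flip_commute)
  have L: "\<not> (P \<in> D \<and> flip a P \<notin> D \<and> flip a (flip b P) \<in> D \<and> flip b P \<notin> D)" if "a \<noteq> b" for P a b
    using no_L_face[OF noL that] by blast
  \<comment> \<open>Two diagonals on each of the six faces. Below, \<open>As\<close> covers the four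
    antipodal pairs in both colourings and \<open>Fs\<close> the six faces.\<close>
  note Ls = L[OF ijk(3), of "v"]
    L[OF ijk(3), of "flip j v"]
    L[OF ijk(3), of "flip i v"]
    L[OF ijk(3), of "flip j (flip i v)"]
    L[OF ijk(2), of "v"]
    L[OF ijk(2), of "flip i v"]
    L[OF ijk(2), of "flip j v"]
    L[OF ijk(2), of "flip i (flip j v)"]
    L[OF ijk(1), of "v"]
    L[OF ijk(1), of "flip i v"]
    L[OF ijk(1), of "flip k v"]
    L[OF ijk(1), of "flip i (flip k v)"]
  note A2 = no_antipodal_disperse[OF two ijk]
  note A6 = no_antipodal_continuous[OF six noT1 ijk]
  have verts: "flip i v \<in> V" "flip j v \<in> V" "flip k v \<in> V" using vV by simp_all
  note As = A2[OF vV] A6[OF vV] A2[OF verts(1)] A6[OF verts(1)]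
    A2[OF verts(2)] A6[OF verts(2)] A2[OF verts(3)] A6[OF verts(3)]
  note Fs = face_rule[OF ijk(1,2) vV] face_rule[OF ijk(1,2) verts(1)]
    face_rule[OF ijk(1)[symmetric] ijk(3) vV] face_rule[OF ijk(1)[symmetric] ijk(3) verts(2)]
    face_rule[OF ijk(2)[symmetric] ijk(3)[symmetric] vV]
    face_rule[OF ijk(2)[symmetric] ijk(3)[symmetric] verts(3)]
  have start: "v \<notin> D" "flip i v \<in> D" "e v i" using v p C_iff by (auto simp: cut_def e_def)
  note all = cube_boundary_connected[OF Ls[unfolded comm flip_flip] As[unfolded comm flip_flip]
      Fs[unfolded comm flip_flip] start]
  have "e w m" if w: "w \<in> V" and cw: "(w \<in> D) \<noteq> (flip m w \<in> D)" for w m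
  proof -
    have e_flip2: "e (flip a (flip m u)) m = e (flip a u) m" for a u
      using e_flip[of m "flip a u"] by (simp add: flip_commute)
    have e_flip3: "e (flip a (flip b (flip m u))) m = e (flip a (flip b u)) m" for a b u
      using e_flip2[of a "flip b u"] by (simp add: flip_commute)
    consider "m = i" | "m = j" | "m = k" using axis_cases[OF ijk] by blast
    then show ?thesis
    proof cases
      case 1
      show ?thesis using w all cw unfolding verts_eq[OF vV ijk] 1
        by (elim insertE emptyE) (auto simp: comm e_flip[of i])
    next
      case 2
      show ?thesis using w all cw unfolding verts_eq[OF vV ijk] 2
        by (elim insertE emptyE) (auto simp: comm e_flip[of j] e_flip2[unfolded 2])
    next
      case 3
      show ?thesis using w all cw unfolding verts_eq[OF vV ijk] 3
        by (elim insertE emptyE) (auto simp: comm e_flip[of k] e_flip2[unfolded 3] e_flip3[unfolded 3])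
    qed
  qed
  moreover obtain w m where w: "cut w m" "q = pt w m" using q unfolding iso_points_iff by blast
  ultimately have "e w m" using C_iff by (auto simp: cut_def)
  moreover have "\<not> cut (flip m w) m" using w C_iff by (auto simp: cut_def)
  ultimately show ?thesis using w by (simp add: e_def)
qed

end

section \<open>Existence and uniqueness of the iso-path\<close>

lemma mod_Suc_asym:
  assumes "3 \<le> n" "i < n" "j < n" "i = Suc j mod n" "j = Suc i mod n"
  shows False
proof (cases "Suc j = n")
  case True
  then have "i = 0" using assms(4) by simp
  then have "j = 1" using assms(1,5) by simp
  then show False using True assms(1) by simp
next
  case False
  then have i: "i = Suc j" using assms(3,4) by simp
  have "Suc i mod n = 0 \<or> Suc i mod n = Suc i" using assms(2) by (cases "Suc i = n") simp_all
  then have "j = 0 \<and> Suc i = n \<or> j = Suc i" using assms(2,5) by (cases "Suc i = n") simp_all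
  then show False using i assms(1) by auto
qed

context cuboid_level
begin

text \<open>Existence is a cycle among the iso-lines. For uniqueness every iso-path is compared with
  the same set \<open>?U\<close>, the union of all iso-lines.\<close>

lemma ex1_iso_path:
  assumes noL: "L_faces c G = {}" and noT1: "\<nexists>H. T1_subgraph c G H" and noT2: "\<nexists>H. T2_subgraph c G H"
    and two: "\<not> (card D = 2 \<and> g1_subgraphs c G \<noteq> {})"
    and six: "\<not> (card D = 6 \<and> g3_subgraphs c G \<noteq> {})"
    and mixed: "\<not> disperse_graph c G" "\<not> continuous_graph c G"
  shows "\<exists>!K. iso_path c G K"
proof -
  let ?R = "iso_line c G"
  \<comment> \<open>Without cut edges one continuous node makes its neighbours, and then all nodes,
    continuous.\<close>
  have ne: "iso_points c G \<noteq> {}"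
  proof
    assume "iso_points c G = {}"
    then have no: "\<not> cut x i" for x i using iso_points_iff by blast
    obtain x where x: "x \<in> V" "x \<in> C"
      using mixed(1) C_iff unfolding disperse_graph_def by blast
    have step: "flip i y \<in> C" if "y \<in> C" for i y
      using no[of y i] that C_iff by (auto simp: cut_def)
    obtain i j k :: 3 where ijk: "i \<noteq> j" "i \<noteq> k" "j \<noteq> k" using obtain_axes by metis
    have "V \<subseteq> C" unfolding verts_eq[OF x(1) ijk] using step x(2) by simp
    then show False using mixed(2) unfolding continuous_graph_def by blast
  qed
  have irrefl: "\<not> ?R p p" for p by (simp add: iso_line_def)
  let ?U = "\<Union>{closed_segment p q | p q. ?R p q}"
  have image: "path_image (polygonal_path (ps @ [hd ps])) = ?U"
    if len: "length ps \<ge> 3" and cyc: "cyclic_chain ?R ps" and dist: "distinct ps" for ps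
  proof -
    have ps: "ps \<noteq> []" using len by auto
    have closed: "\<exists>i<length ps. {p, q} = {ps ! i, ps ! (Suc i mod length ps)}"
      if "p \<in> set ps" "?R p q" for p q
      by (rule cyclic_chain_neighbor[OF cyc len dist _ _ that])
        (use iso_line_commute iso_line_degree_le_2 in blast)+
    \<comment> \<open>The vertices of the chain are closed under iso-lines, so by connectedness they
      exhaust the iso-points.\<close>
    have "q \<in> set ps" if "p \<in> set ps" "?R p q" for p q
    proof -
      obtain i where i: "i < length ps" "{p, q} = {ps ! i, ps ! (Suc i mod length ps)}"
        using closed[OF \<open>p \<in> set ps\<close> \<open>?R p q\<close>] by blast
      have "Suc i mod length ps < length ps" using ps by simp
      then have "{p, q} \<subseteq> set ps" using i by (simp add: nth_mem)
      then show ?thesis by simp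
    qed
    moreover have "hd ps \<in> set ps" using ps by simp
    moreover have "hd ps \<in> iso_points c G"
    proof -
      have "0 < length ps" using ps by simp
      then have "?R (ps ! 0) (ps ! (Suc 0 mod length ps))" using cyc unfolding cyclic_chain_def by blast
      then show ?thesis using iso_line_iso_points(1) ps by (simp add: hd_conv_nth)
    qed
    ultimately have all: "iso_points c G \<subseteq> set ps"
      using iso_points_connected[OF noL noT1 two six, of "set ps" "hd ps"] by blast
    have "closed_segment p q \<subseteq> (\<Union>i<length ps. closed_segment (ps ! i) (ps ! (Suc i mod length ps)))"
      if pq: "?R p q" for p q
    proof -
      obtain i where i: "i < length ps" "{p, q} = {ps ! i, ps ! (Suc i mod length ps)}"
        using closed[OF _ pq] all iso_line_iso_points(1)[OF pq] by blast
      then have "closed_segment p q = closed_segment (ps ! i) (ps ! (Suc i mod length ps))"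
        by (auto simp: doubleton_eq_iff closed_segment_commute)
      then show ?thesis using i by blast
    qed
    then show ?thesis
      unfolding path_image_closed_polygonal_path[OF ps] using cyc unfolding cyclic_chain_def by blast
  qed
  have unique: "K = ?U" if K: "iso_path c G K" for K
  proof -
    obtain ps where ps: "length ps \<ge> 3" "cyclic_chain ?R ps"
      "simple_path (polygonal_path (ps @ [hd ps]))" "K = path_image (polygonal_path (ps @ [hd ps]))"
      using K unfolding iso_path_def cyclic_chain_def by blast
    have "distinct ps" by (rule distinct_if_simple_closed_polygonal_path[OF ps(1,3)])
    then show ?thesis unfolding ps(4) by (rule image[OF ps(1,2)])
  qed
  have "\<exists>K. iso_path c G K"
  proof -
    have deg: "\<exists>q1\<in>iso_points c G. \<exists>q2\<in>iso_points c G. q1 \<noteq> q2 \<and> ?R p q1 \<and> ?R p q2"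
      if "p \<in> iso_points c G" for p
      using iso_line_degree_ge_2[OF noL noT1 noT2 that] iso_line_iso_points(2) by blast
    obtain ps where ps: "length ps \<ge> 3" "distinct ps" "cyclic_chain ?R ps"
      using ex_cyclic_chain[of "iso_points c G" ?R, OF finite_iso_points ne] iso_line_commute irrefl deg
      by blast
    let ?n = "length ps"
    let ?s = "\<lambda>i. Suc i mod length ps"
    have lines: "?R (ps ! i) (ps ! ?s i)" if "i < ?n" for i
      using ps(3) that by (simp add: cyclic_chain_def)
    have "simple_path (polygonal_path (ps @ [hd ps]))"
    proof (rule simple_closed_polygonal_path[OF ps(1,2)])
      fix i j assume ij: "i < j" "j < ?n"
      have s: "?s i < ?n" "?s j < ?n" by (rule mod_less_divisor, use ij in linarith)+
      \<comment> \<open>Two sides with the same vertices would have indices that are cyclic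
        successors of each other, which length at least 3 forbids.\<close>
      have "{ps ! i, ps ! ?s i} \<noteq> {ps ! j, ps ! ?s j}"
      proof
        assume "{ps ! i, ps ! ?s i} = {ps ! j, ps ! ?s j}"
        moreover have "ps ! i \<noteq> ps ! j" using ij ps(2) by (simp add: nth_eq_iff_index_eq)
        ultimately have "ps ! i = ps ! ?s j" "ps ! ?s i = ps ! j" by (auto simp: doubleton_eq_iff)
        have "i < ?n" using ij by simp
        moreover have "i = ?s j" using \<open>ps ! i = ps ! ?s j\<close> ps(2) \<open>i < ?n\<close> s(2)
          by (simp only: nth_eq_iff_index_eq)
        moreover have "j = ?s i" using \<open>ps ! ?s i = ps ! j\<close> ps(2) ij(2) s(1) by (simp only: nth_eq_iff_index_eq)
        ultimately show False using mod_Suc_asym[OF ps(1) _ ij(2)] by blast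
      qed
      then show "closed_segment (ps ! i) (ps ! ?s i) \<inter> closed_segment (ps ! j) (ps ! ?s j)
        \<subseteq> {ps ! i, ps ! ?s i} \<inter> {ps ! j, ps ! ?s j}"
        by (rule iso_lines_disjoint[rotated 2]) (rule lines, use ij in simp)+
    qed
    then show ?thesis unfolding iso_path_def using ps(1) lines by blast
  qed
  then obtain K where K: "iso_path c G K" by blast
  show ?thesis
  proof (rule ex1I[of _ K])
    show "iso_path c G K" by (rule K)
    fix L assume "iso_path c G L"
    then have "L = ?U" by (rule unique)
    also have "?U = K" using unique[OF K] by (rule sym)
    finally show "L = K" .
  qed
qed

section \<open>Reduced positive surface measure subgraphs\<close>

text \<open>The only candidate when no disperse node is isolated.\<close>

definition disperse_subgraph :: cuboid_subgraph where
  "disperse_subgraph = (let W = D \<union> {Q \<in> C. \<exists>P\<in>D. incident G P Q} in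
     \<lparr>sverts = W, sedges = {e \<in> edges G. e \<inter> D \<noteq> {}}, slabel = restrict (label G) W\<rparr>)"

lemma disperse_subgraph_simps [simp]:
  "sverts disperse_subgraph = D \<union> {Q \<in> C. \<exists>P\<in>D. incident G P Q}"
  "sedges disperse_subgraph = {e \<in> edges G. e \<inter> D \<noteq> {}}"
  "slabel disperse_subgraph = restrict (label G) (D \<union> {Q \<in> C. \<exists>P\<in>D. incident G P Q})"
  by (simp_all add: disperse_subgraph_def Let_def)

lemma subgraph_disperse_subgraph: "subgraph disperse_subgraph G"
  unfolding subgraph_def
proof (intro conjI ballI)
  show "sverts disperse_subgraph \<subseteq> V" using D_verts C_iff by auto
  show "sedges disperse_subgraph \<subseteq> edges G" by auto
  fix e assume e: "e \<in> sedges disperse_subgraph"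
  then obtain P Q where PQ: "e = {P, Q}" "P \<in> D" "incident G P Q"
    by (auto elim!: edgeE simp: doubleton_eq_iff) (metis D_verts incident_flip incident_iff insert_commute)+
  then have "Q \<in> V" by (auto simp: incident_iff)
  then show "e \<subseteq> sverts disperse_subgraph" using PQ C_iff by auto
next
  show "slabel disperse_subgraph = restrict (label G) (sverts disperse_subgraph)" by simp
next
  fix P assume P: "P \<in> sverts disperse_subgraph"
  then obtain Q where "incident G P Q" "P \<in> D \<or> Q \<in> D"
    using incident_flip(1)[OF D_verts, of P 1] incident_commute by auto
  then have "{P, Q} \<in> sedges disperse_subgraph" by (auto simp: incident_def)
  then show "\<exists>e\<in>sedges disperse_subgraph. P \<in> e" by blast
qed

text \<open>Given all disperse nodes, the conditions on continuous nodes fix the node set, and those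
  on edges give both inclusions for the edge set.\<close>

lemma eq_disperse_subgraph:
  assumes H: "subgraph H G" and D: "D \<subseteq> sverts H"
    and DD: "\<forall>P\<in>D. \<forall>Q\<in>D. incident G P Q \<longrightarrow> {P, Q} \<in> sedges H"
    and DC: "\<forall>P\<in>sverts H \<inter> D. \<forall>Q\<in>C. incident G P Q \<longrightarrow> Q \<in> sverts H \<and> {P, Q} \<in> sedges H"
    and CD: "\<forall>Q\<in>sverts H \<inter> C. \<exists>P\<in>sverts H \<inter> D. incident G P Q"
    and e: "\<forall>e\<in>sedges H. \<exists>P\<in>e. P \<in> D"
  shows "H = disperse_subgraph"
proof -
  have v: "sverts H = D \<union> {Q \<in> C. \<exists>P\<in>D. incident G P Q}"
  proof (intro equalityI subsetI)
    fix Q assume Q: "Q \<in> sverts H"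
    then have "Q \<in> D \<or> Q \<in> C" using H unfolding subgraph_def C_iff by blast
    then show "Q \<in> D \<union> {Q \<in> C. \<exists>P\<in>D. incident G P Q}" using CD Q by blast
  next
    fix Q assume "Q \<in> D \<union> {Q \<in> C. \<exists>P\<in>D. incident G P Q}"
    then show "Q \<in> sverts H" using D DC by blast
  qed
  have "{P, flip i P} \<in> sedges H" if "P \<in> D" for P i
  proof -
    have "flip i P \<in> D \<or> flip i P \<in> C" "incident G P (flip i P)"
      using D_verts[OF that] by (auto simp: C_iff)
    then show ?thesis using DD DC D that by blast
  qed
  moreover have "{P, flip i P} \<in> sedges H" if "flip i P \<in> D" for P i
    using calculation[OF that, of i] by (simp add: insert_commute)
  ultimately have "{e \<in> edges G. e \<inter> D \<noteq> {}} \<subseteq> sedges H"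
    by (auto elim!: edgeE)
  moreover have "sedges H \<subseteq> edges G" using H by (simp add: subgraph_def)
  then have "sedges H \<subseteq> {e \<in> edges G. e \<inter> D \<noteq> {}}" using e by fast
  ultimately have s: "sedges H = {e \<in> edges G. e \<inter> D \<noteq> {}}" by (rule equalityI[rotated])
  have "slabel H = restrict (label G) (sverts H)" using H by (simp add: subgraph_def)
  then show ?thesis using v s by (intro cuboid_subgraph.equality) simp_all
qed

text \<open>Diagonal disperse nodes are joined through a third one because there are no L-faces. For
  an antipodal pair, one step to a disperse neighbour leaves a diagonal pair.\<close>

lemma disperse_connected:
  assumes noL: "L_faces c G = {}" and nb: "\<And>P. P \<in> D \<Longrightarrow> \<exists>i. flip i P \<in> D"
    and PQ: "P \<in> D" "Q \<in> D"
  shows "(P, Q) \<in> {(x, y). {x, y} \<in> sedges disperse_subgraph \<and> {x, y} \<subseteq> D}\<^sup>*" (is "_ \<in> ?r\<^sup>*")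
proof -
  have step: "(x, flip a x) \<in> ?r" if "x \<in> D" "flip a x \<in> D" for x a
    using that D_verts by (auto simp: edge_iff)
  have diag: "(x, flip a (flip b x)) \<in> ?r\<^sup>*" if x: "x \<in> D" "flip a (flip b x) \<in> D" for x a b
  proof (cases "a = b")
    case False
    then consider "flip a x \<in> D" | "flip b x \<in> D" using no_L_face[OF noL _ x] by blast
    then show ?thesis
    proof cases
      case 1
      have "(flip a x, flip b (flip a x)) \<in> ?r" by (rule step) (use 1 x(2) flip_commute[of b a x] in simp_all)
      then have "(flip a x, flip a (flip b x)) \<in> ?r" unfolding flip_commute[of b a] .
      with step[OF x(1) 1] show ?thesis by (rule rtrancl_into_rtrancl[OF r_into_rtrancl])
    next
      case 2
      show ?thesis using step[OF x(1) 2] step[OF 2 x(2)] by (rule rtrancl_into_rtrancl[OF r_into_rtrancl])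
    qed
  qed simp
  obtain i where i: "flip i P \<in> D" using nb PQ by blast
  obtain j k where ijk: "i \<noteq> j" "i \<noteq> k" "j \<noteq> k" by (rule obtain_axes)
  have "Q \<in> V" using PQ D_verts by blast
  then consider "Q = P" | a where "Q = flip a P" | a b where "Q = flip a (flip b P)"
    | "Q = flip i (flip j (flip k P))"
    unfolding verts_eq[OF D_verts[OF PQ(1)] ijk] by blast
  then show ?thesis
  proof cases
    case 4
    then have "Q = flip j (flip k (flip i P))" by (simp add: flip_commute)
    then have "(flip i P, Q) \<in> ?r\<^sup>*" using diag i PQ by blast
    then show ?thesis using step[OF PQ(1) i] by (rule converse_rtrancl_into_rtrancl[rotated])
  qed (use PQ step diag in blast)+
qed

text \<open>Neighbours of a centre are disperse, so two centres are not incident; diagonal centres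
  would produce an L-face; antipodal ones would leave exactly six disperse nodes.\<close>

lemma no_two_g3:
  assumes noL: "L_faces c G = {}" and six: "\<not> (card D = 6 \<and> g3_subgraphs c G \<noteq> {})"
    and "A \<in> g3_subgraphs c G" "B \<in> g3_subgraphs c G"
  shows "A = B"
proof -
  obtain P where P: "P \<in> V" "label G P < c" "\<And>m. flip m P \<in> D" "A = star P"
    using assms(3) by (rule g3E) blast
  obtain Q where Q: "Q \<in> V" "label G Q < c" "\<And>m. flip m Q \<in> D" "B = star Q"
    using assms(4) by (rule g3E) blast
  have nD: "P \<notin> D" "Q \<notin> D" using P Q by (auto simp: disperse_nodes_def)
  obtain i j k :: 3 where ijk: "i \<noteq> j" "i \<noteq> k" "j \<noteq> k" using obtain_axes by metis
  have nflip: "Q \<noteq> flip a P" for a using P(3)[of a] nD by metis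
  have ndiag: "Q \<noteq> flip a (flip b P)" if "a \<noteq> b" for a b
  proof
    assume eq: "Q = flip a (flip b P)"
    have "flip a (flip b (flip a P)) \<in> D" using P(3)[of b] by (simp add: flip_commute[of b a])
    then have "flip a (flip a P) \<in> D \<or> flip b (flip a P) \<in> D"
      using no_L_face[OF noL that P(3)[of a]] by blast
    then show False using nD eq by (simp add: flip_commute[of b a])
  qed
  have "Q = P \<or> Q = flip i (flip j (flip k P))"
    using Q(1) nflip ndiag[OF ijk(1)] ndiag[OF ijk(2)] ndiag[OF ijk(3)]
    unfolding verts_eq[OF P(1) ijk] by blast
  moreover have False if eq: "Q = flip i (flip j (flip k P))"
  proof -
    have D: "flip j (flip k P) \<in> D" "flip i (flip k P) \<in> D" "flip i (flip j P) \<in> D"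
      using Q(3)[of i] Q(3)[of j] Q(3)[of k] unfolding eq
      by (simp_all add: flip_commute[of j i] flip_commute[of k i] flip_commute[of k j])
    have "V - {P, Q} \<subseteq> D" unfolding verts_eq[OF P(1) ijk] eq using D P(3) by blast
    then have "D = V - {P, Q}" using nD D_verts by blast
    then have "card D = 6" using P(1) Q(1) eq ijk card_verts by (simp add: card_Diff_subset)
    then show False using six assms(3) by blast
  qed
  ultimately show ?thesis using P Q by blast
qed

text \<open>The continuous nodes of an L-face are diagonal, so each of its edges has a disperse end
  and belongs to \<open>H\<close>.\<close>

lemma contains_L_face:
  assumes S: "S \<in> L_faces c G" and D: "D \<subseteq> sverts H"
    and DC: "\<And>P Q. P \<in> D \<Longrightarrow> incident G P Q \<Longrightarrow> Q \<in> sverts H \<and> {P, Q} \<in> sedges H"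
  shows "contains_face G H S"
proof -
  obtain P i j k where P: "i \<noteq> j" "i \<noteq> k" "j \<noteq> k" "S = face i P" "P \<in> D"
     "flip j (flip k P) \<in> D" "flip j P \<in> C" "flip k P \<in> C" using S unfolding L_face_iff by blast
  have PV: "P \<in> V" using P D_verts by blast
  have nodes: "S \<inter> V = {P, flip j P, flip k P, flip j (flip k P)}"
    unfolding P(4) by (rule face_verts[OF PV P(1-3)])
  have inc: "incident G P (flip j P)" "incident G P (flip k P)" using PV by simp_all
  then have v: "S \<inter> V \<subseteq> sverts H" unfolding nodes using D DC P by blast
  have "e \<in> sedges H" if e: "e \<in> edges G" "e \<subseteq> S" for e
  proof -
    obtain x a where x: "x \<in> V" "e = {x, flip a x}" by (rule edgeE[OF e(1)])
    have n: "x \<in> S \<inter> V" "flip a x \<in> S \<inter> V" using x e by auto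
    have i: "incident G x (flip a x)" "incident G (flip a x) x" using x by auto
    have "\<not> incident G (flip j P) (flip j (flip k (flip j P)))"
      by (rule not_incident_diagonal[OF P(3)])
    then have jk: "\<not> incident G (flip j P) (flip k P)" by (simp add: flip_commute[of k j])
    have "x \<in> D \<or> flip a x \<in> D"
    proof (rule ccontr)
      assume no: "\<not> ?thesis"
      have "y = flip j P \<or> y = flip k P" if "y \<in> S \<inter> V" "y \<notin> D" for y
        using that P(5,6) unfolding nodes by blast
      then have "x = flip j P \<or> x = flip k P" "flip a x = flip j P \<or> flip a x = flip k P"
        using n no by simp_all
      then show False using i jk not_incident_self by metis
    qed
    then show ?thesis using DC i x by (metis insert_commute)
  qed
  then show ?thesis using v by (auto simp: contains_face_def)
qed

end

section \<open>Irreducibility and the unique reduced subgraph\<close>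

theorem theorem5p9:
  fixes c :: real and M :: "cuboid_graph set" and G :: cuboid_graph
  assumes "0 < c" and "c < 1"
    and "cuboid_mesh M" and "G \<in> M"
    and "regular_graph c M G"
  shows "(\<forall>H. reduced_psm_subgraph c M G H \<and>
              (\<forall>H'. reduced_psm_subgraph c M G H' \<longrightarrow> H' = H) \<and>
              disperse_nodes c G \<subseteq> sverts H
           \<longrightarrow> irreducible_graph c M G \<and> (\<exists>!K. iso_path c G K)) \<and>
         (irreducible_graph c M G \<longrightarrow>
           (\<exists>H. subgraph H G \<and> reduced_psm_subgraph c M G H \<and>
                (\<forall>H'. reduced_psm_subgraph c M G H' \<longrightarrow> H' = H) \<and>
                disperse_nodes c G \<subseteq> sverts H))"
proof -
  interpret cuboid_level c G
    using assms(3,4) by unfold_locales (simp add: cuboid_mesh_def labeled_cuboid_graph_def)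
  have noT1: "\<nexists>H. T1_subgraph c G H" and noT2: "\<nexists>H. T2_subgraph c G H"
    and mixed: "\<not> disperse_graph c G" "\<not> continuous_graph c G"
    using assms(5) by (auto simp: regular_graph_def)
  have irreducible_iff: "irreducible_graph c M G \<longleftrightarrow> L_faces c G = {} \<and>
      \<not> (card D = 2 \<and> g1_subgraphs c G \<noteq> {}) \<and> \<not> (card D = 6 \<and> g3_subgraphs c G \<noteq> {})"
    using assms(5) by (auto simp: irreducible_graph_def reducible_graph_def)
  have irreducible: "irreducible_graph c M G"
    if H: "reduced_psm_subgraph c M G H" and D: "D \<subseteq> sverts H" for H
  proof (cases "H \<in> g1_subgraphs c G")
    case True
    then obtain P where P: "P \<in> D" "\<And>m. flip m P \<in> C" "H = star P" by (rule g1E) blast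
    \<comment> \<open>All disperse nodes lie in the star of \<open>P\<close>, whose outer nodes are
      continuous. A single disperse node is too few for every cause of reducibility.\<close>
    have "D \<subseteq> {P}"
    proof
      fix Q assume Q: "Q \<in> D"
      then have "Q = P \<or> incident G P Q" using D P(3) by auto
      then show "Q \<in> {P}" using P(2) Q C_iff by (auto simp: incident_iff)
    qed
    then have "D = {P}" using P by blast
    then have "card D = 1" by simp
    moreover have "L_faces c G = {}"
    proof (rule equals0I)
      fix S assume "S \<in> L_faces c G"
      then have "card (S \<inter> D) = 2" by (simp add: L_faces_def)
      moreover have "card (S \<inter> D) \<le> card D" using \<open>D = {P}\<close> by (intro card_mono) auto
      ultimately show False using \<open>card D = 1\<close> by simp
    qed
    ultimately show ?thesis unfolding irreducible_iff by simp
  next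
    case False
    note conds = H[unfolded reduced_psm_subgraph_def]
    have sub: "subgraph H G" by (rule conds[THEN conjunct2, THEN conjunct1])
    note conds[THEN conjunct2, THEN conjunct2, unfolded disj_imp, THEN mp, OF False]
    then have card2: "2 \<le> card (sverts H \<inter> D)"
      and DD: "\<forall>P\<in>D. \<forall>Q\<in>D. incident G P Q \<longrightarrow> {P, Q} \<in> sedges H"
      and conn: "\<forall>P\<in>sverts H \<inter> D. \<forall>Q\<in>sverts H \<inter> D. P \<noteq> Q \<longrightarrow>
          (P, Q) \<in> {(x, y). {x, y} \<in> sedges H \<and> {x, y} \<subseteq> D}\<^sup>*"
      and DC: "\<forall>P\<in>sverts H \<inter> D. \<forall>Q\<in>C. incident G P Q \<longrightarrow> Q \<in> sverts H \<and> {P, Q} \<in> sedges H"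
      and L: "\<not> (\<exists>S\<in>L_faces c G. contains_face G H S)"
      and g3: "\<not> (\<exists>A\<in>g3_subgraphs c G. \<exists>B\<in>g3_subgraphs c G.
            A \<noteq> B \<and> contains_subgraph H A \<and> contains_subgraph H B)"
      by - (elim conjE, assumption)+
    have inc: "Q \<in> sverts H \<and> {P, Q} \<in> sedges H" if "P \<in> D" "incident G P Q" for P Q
    proof -
      have "Q \<in> D \<or> Q \<in> C" using that(2) by (auto simp: incident_iff C_iff)
      then show ?thesis using DD DC D that by blast
    qed
    have noL: "L_faces c G = {}" using L contains_L_face[OF _ D inc] by blast
    have "g1_subgraphs c G = {}"
    proof (rule equals0I)
      fix A assume "A \<in> g1_subgraphs c G"
      then obtain P where P: "P \<in> D" "\<And>m. flip m P \<in> C" by (rule g1E) blast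
      have "\<not> sverts H \<inter> D \<subseteq> {P}" using card2 card_mono[of "{P}" "sverts H \<inter> D"] by auto
      then obtain Q where Q: "Q \<in> sverts H \<inter> D" "P \<noteq> Q" by blast
      then have "(P, Q) \<in> {(x, y). {x, y} \<in> sedges H \<and> {x, y} \<subseteq> D}\<^sup>*" using conn P(1) D by blast
      \<comment> \<open>The first edge of a disperse path from \<open>P\<close> to \<open>Q\<close>
        contradicts the isolation of \<open>P\<close>.\<close>
      then obtain y where y: "{P, y} \<in> sedges H" "y \<in> D" using Q(2) by (auto elim: converse_rtranclE)
      then have "{P, y} \<in> edges G" using sub by (auto simp: subgraph_def)
      then obtain m where "y = flip m P" by (auto simp: edge_iff)
      then show False using P(2) y(2) C_iff by blast
    qed
    moreover have "\<not> (card D = 6 \<and> g3_subgraphs c G \<noteq> {})"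
    proof
      assume "card D = 6 \<and> g3_subgraphs c G \<noteq> {}"
      then obtain A where card6: "card D = 6" and A: "A \<in> g3_subgraphs c G" by blast
      obtain P where P: "P \<in> V" "label G P < c" "\<And>m. flip m P \<in> D" "A = star P"
        using A by (rule g3E) blast
      have PC: "P \<in> C" using P by (simp add: continuous_nodes_def)
      have VD: "D \<subseteq> V" using D_verts by blast
      \<comment> \<open>Besides \<open>P\<close> there is exactly one continuous node
        \<open>Q\<close>. It is not incident to \<open>P\<close>, so it is the centre of a second
        member of \<open>g3_subgraphs\<close>, and \<open>H\<close> would contain both
        stars.\<close>
      have "card (V - D) = 2"
        using card6 card_verts VD by (simp add: card_Diff_subset finite_subset[OF VD])
      then have "\<not> V - D \<subseteq> {P}" using card_mono[of "{P}" "V - D"] by auto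
      then obtain Q where Q: "Q \<in> V" "Q \<notin> D" "Q \<noteq> P" by blast
      have "card (V - D) = card {P, Q}" using \<open>card (V - D) = 2\<close> Q by simp
      then have VDeq: "V - D = {P, Q}"
        using card_subset_eq[of "V - D" "{P, Q}"] Q PC C_iff by auto
      have QD: "flip m Q \<in> D" for m
      proof (rule ccontr)
        assume "flip m Q \<notin> D"
        then have "flip m Q \<in> {P, Q}" using VDeq Q(1) by auto
        then have "flip m Q = P" using Q(1) by auto
        then have "Q = flip m P" by auto
        then show False using P(3) Q(2) by blast
      qed
      have "Q \<in> C" using Q C_iff by blast
      then have "label G Q < c" using label_less_if_T1_free[OF noT1 _ QD] by blast
      then have B: "star Q \<in> g3_subgraphs c G" using star_in_g3 Q(1) QD by blast
      have contains: "contains_subgraph H (star R)" if R: "R \<in> V" "\<And>m. flip m R \<in> D" for R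
      proof -
        have nb: "Q \<in> D \<and> incident G Q R" if "incident G R Q" for Q
          using that R(2) incident_commute[of R Q] by (auto simp: incident_iff[of R Q])
        then have "sverts (star R) \<subseteq> sverts H"
          using inc[of "flip 1 R" R] R D incident_flip(2)[OF R(1), of 1] by auto
        moreover have "{R, Q} \<in> sedges H" if "incident G R Q" for Q
          using nb[OF that] inc[of Q R] by (simp add: insert_commute)
        ultimately show ?thesis by (auto simp: contains_subgraph_def)
      qed
      have "star P \<noteq> star Q"
      proof
        assume "star P = star Q"
        then have "P \<in> sverts (star Q)" by (metis insertI1 star_simps(1))
        then have "incident G Q P" using Q by auto
        then show False using QD PC C_iff by (auto simp: incident_iff)
      qed
      then show False using g3 A B P contains Q QD by blast
    qed
    ultimately show ?thesis using noL unfolding irreducible_iff by simp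
  qed
  have "\<exists>H. subgraph H G \<and> reduced_psm_subgraph c M G H \<and>
      (\<forall>H'. reduced_psm_subgraph c M G H' \<longrightarrow> H' = H) \<and> D \<subseteq> sverts H"
    if irr: "irreducible_graph c M G"
  proof -
    have noL: "L_faces c G = {}" and two: "\<not> (card D = 2 \<and> g1_subgraphs c G \<noteq> {})"
      and six: "\<not> (card D = 6 \<and> g3_subgraphs c G \<noteq> {})"
      using irr unfolding irreducible_iff by auto
    \<comment> \<open>An isolated disperse node turns out to be the only disperse node, and its star
      is the subgraph sought; otherwise \<open>disperse_subgraph\<close> is.\<close>
    show ?thesis
    proof (cases "\<exists>P\<in>D. \<forall>i. flip i P \<in> C")
      case True
      then obtain P where P: "P \<in> D" "\<And>i. flip i P \<in> C" by blast
      have PV: "P \<in> V" using P D_verts by blast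
      have nflip: "flip a P \<notin> D" for a using P(2) C_iff by blast
      have ndiag: "flip a (flip b P) \<notin> D" if "a \<noteq> b" for a b
        using no_L_face[OF noL that P(1)] nflip by blast
      obtain i j k :: 3 where ijk: "i \<noteq> j" "i \<noteq> k" "j \<noteq> k" using obtain_axes by metis
      have "flip i (flip j (flip k P)) \<notin> D"
        using no_antipodal_disperse[OF two ijk PV] nflip ndiag ijk P(1) by blast
      then have D: "Q = P" if "Q \<in> D" for Q
        using that D_verts[OF that] nflip ndiag ijk unfolding verts_eq[OF PV ijk] by blast
      have g1: "star P \<in> g1_subgraphs c G" using star_in_g1 P by blast
      have "H' = star P" if H': "reduced_psm_subgraph c M G H'" for H'
      proof (cases "H' \<in> g1_subgraphs c G")
        case True
        then obtain Q where "Q \<in> D" "H' = star Q" by (rule g1E)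
        then show ?thesis using D by blast
      next
        case False
        then have "2 \<le> card (sverts H' \<inter> D)" using H' unfolding reduced_psm_subgraph_def by blast
        moreover have "card (sverts H' \<inter> D) \<le> card {P}" using D by (intro card_mono) auto
        ultimately show ?thesis by simp
      qed
      moreover have "reduced_psm_subgraph c M G (star P)"
        using g1 assms(5) subgraph_star[OF PV] unfolding reduced_psm_subgraph_def by blast
      moreover have "D \<subseteq> sverts (star P)" using D by auto
      ultimately show ?thesis using subgraph_star[OF PV] by blast
    next
      case False
      then have nb: "\<exists>i. flip i P \<in> D" if "P \<in> D" for P
        using that D_verts[OF that] C_iff by auto
      let ?H = disperse_subgraph
      have g1: "g1_subgraphs c G = {}"
        using False g1E by (metis equals0I)
      obtain P where P: "P \<in> D"
        using mixed(2) C_iff unfolding continuous_graph_def by blast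
      obtain i where i: "flip i P \<in> D" using nb P by blast
      have "{P, flip i P} \<subseteq> sverts ?H \<inter> D" using P i by simp
      moreover have "finite (sverts ?H \<inter> D)"
        by (rule finite_subset[OF _ finite_verts]) (use D_verts in blast)
      ultimately have "card {P, flip i P} \<le> card (sverts ?H \<inter> D)" by (intro card_mono)
      then have card2: "2 \<le> card (sverts ?H \<inter> D)" using D_verts[OF P] by simp
      have "reduced_psm_subgraph c M G ?H"
        unfolding reduced_psm_subgraph_def
      proof (intro conjI disjI2)
        show "\<forall>P\<in>sverts ?H \<inter> D. \<forall>Q\<in>sverts ?H \<inter> D. P \<noteq> Q \<longrightarrow>
          (P, Q) \<in> {(x, y). {x, y} \<in> sedges ?H \<and> {x, y} \<subseteq> D}\<^sup>*"
          using disperse_connected[OF noL nb] by blast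
        show "\<not> (\<exists>A\<in>g3_subgraphs c G. \<exists>B\<in>g3_subgraphs c G.
            A \<noteq> B \<and> contains_subgraph ?H A \<and> contains_subgraph ?H B)"
          using no_two_g3[OF noL six] by blast
      qed (use assms(5) subgraph_disperse_subgraph card2 noL in \<open>auto simp: incident_def C_iff\<close>)
      moreover have "H' = ?H" if H': "reduced_psm_subgraph c M G H'" for H'
      proof (rule eq_disperse_subgraph)
        have no: "H' \<notin> g1_subgraphs c G" using g1 by blast
        note conds = H'[unfolded reduced_psm_subgraph_def]
        have sub: "subgraph H' G" by (rule conds[THEN conjunct2, THEN conjunct1])
        note conds[THEN conjunct2, THEN conjunct2, unfolded disj_imp, THEN mp, OF no]
        then have *: "\<forall>P\<in>D. \<forall>Q\<in>D. incident G P Q \<longrightarrow> {P, Q} \<in> sedges H'"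
           "\<forall>P\<in>sverts H' \<inter> D. \<forall>Q\<in>C. incident G P Q \<longrightarrow> Q \<in> sverts H' \<and> {P, Q} \<in> sedges H'"
           "\<forall>Q\<in>sverts H' \<inter> C. \<exists>P\<in>sverts H' \<inter> D. incident G P Q"
           "\<forall>e\<in>sedges H'. \<exists>P\<in>e. P \<in> D"
          by - (elim conjE, assumption)+
        then show "\<forall>P\<in>D. \<forall>Q\<in>D. incident G P Q \<longrightarrow> {P, Q} \<in> sedges H'"
           "\<forall>P\<in>sverts H' \<inter> D. \<forall>Q\<in>C. incident G P Q \<longrightarrow> Q \<in> sverts H' \<and> {P, Q} \<in> sedges H'"
           "\<forall>Q\<in>sverts H' \<inter> C. \<exists>P\<in>sverts H' \<inter> D. incident G P Q"
           "\<forall>e\<in>sedges H'. \<exists>P\<in>e. P \<in> D" "subgraph H' G" using sub by this+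
        \<comment> \<open>Each disperse node has a disperse neighbour, and the edge joining them
          lies in \<open>H'\<close>, so its end points do as well.\<close>
        show "D \<subseteq> sverts H'"
        proof
          fix P assume P: "P \<in> D"
          obtain i where "flip i P \<in> D" using nb P by blast
          then have "{P, flip i P} \<in> sedges H'" using *(1) P D_verts[OF P] by auto
          then show "P \<in> sverts H'" using sub unfolding subgraph_def by blast
        qed
      qed
      moreover have "D \<subseteq> sverts ?H" by simp
      ultimately show ?thesis using subgraph_disperse_subgraph by blast
    qed
  qed
  moreover have "\<exists>!K. iso_path c G K" if "irreducible_graph c M G"
    by (rule ex1_iso_path[OF _ noT1 noT2 _ _ mixed]) (use that[unfolded irreducible_iff] in simp_all)
  ultimately show ?thesis using irreducible by blast
qed

end
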